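(* Let Model 17 be the step set $\{(0,1),(-1,0),(1,-1)\}$ and Model 18 the step set $\{(1,0),(-1,0),(0,1),(0,-1),(1,-1),(-1,1)\}$. For each of these let $G(t;a,b)$ be the length generating function of quarter plane walks starting and ending at the origin, with weight $a$ per visit to the line $y=0$ and weight $b$ per visit to the line $x=0$. (i) For Model 17: for general values of $a$ and $b$, $G(t;a,b)$ can be written as the ratio of two D-finite functions (of $t$); moreover $G(t;a,1)$ and $G(t;1,b)$ are D-finite. (ii) For Model 18: $G(t;a,a)$ can be written as the ratio of two D-finite functions (of $t$).
   Context: Given a step set $\mathcal{S}\subseteq\{-1,0,1\}^2\setminus\{(0,0)\}$, a quarter plane walk of length $n$ is a walk in $\mathbb{Z}_{\ge 0}^2$ starting at $(0,0)$ and taking $n$ steps from $\mathcal{S}$, all of whose vertices lie in $\mathbb{Z}_{\ge0}^2$. Let $q_{n,k,\ell,h,v}$ be the number of such walks of length $n$ ending at $(k,\ell)$ which visit the horizontal boundary $y=0$ exactly $h$ times and the vertical boundary $x=0$ exactly $v$ times. The origin belongs to both boundaries, so a visit to the origin contributes $1$ to both $h$ and $v$ (weight $ab$). The starting vertex is not counted as a visit, so the empty walk has weight $1$. Define $$G(t;a,b)=\sum_{n\ge0}t^n\sum_{h,v\ge0}q_{n,0,0,h,v}\,a^hb^v\in\mathbb{Z}[a,b][[t]].$$ D-finite means: a formal series in $t$ which satisfies a non-trivial linear differential equation with respect to $t$ with polynomial coefficients in $t$. "General values of $a$ and $b$" means that $a,b$ are regarded as indeterminates, i.e. the base field of coefficients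 is $\mathbb{Q}(a,b)$ (so the polynomial coefficients lie in $\mathbb{Q}(a,b)[t]$, and similarly with $\mathbb{Q}(a)$ or $\mathbb{Q}(b)$ when only one variable is present). A ratio of two D-finite functions means $F/H$ with $F,H$ D-finite formal series in $t$ and $H\neq0$. *)

theory Defs
  imports
    "HOL-Computational_Algebra.Computational_Algebra"
    "HOL-Library.Product_Plus"
begin

text \<open>A walk is encoded by its list of steps; \<open>vertex w i\<close> is its position after \<open>i\<close> steps,
  so \<open>vertex w 0\<close> is the origin.\<close>

type_synonym step = "int \<times> int"

definition vertex :: "step list \<Rightarrow> nat \<Rightarrow> int \<times> int" where
  "vertex w i = sum_list (take i w)"

definition quarter_plane_walks :: "step set \<Rightarrow> nat \<Rightarrow> step list set" where
  "quarter_plane_walks S n =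
     {w. length w = n \<and> set w \<subseteq> S \<and>
         (\<forall>i\<le>n. fst (vertex w i) \<ge> 0 \<and> snd (vertex w i) \<ge> 0)}"

text \<open>The starting vertex (index \<open>0\<close>) does not count as a visit. A later visit to the origin
  counts once for each of the two boundaries.\<close>

definition horizontal_visits :: "step list \<Rightarrow> nat" where
  "horizontal_visits w = card {i \<in> {1..length w}. snd (vertex w i) = 0}"

definition vertical_visits :: "step list \<Rightarrow> nat" where
  "vertical_visits w = card {i \<in> {1..length w}. fst (vertex w i) = 0}"

definition num_walks :: "step set \<Rightarrow> nat \<Rightarrow> nat \<Rightarrow> nat \<Rightarrow> nat \<Rightarrow> nat \<Rightarrow> nat" where
  "num_walks S n k l h v =
     card {w \<in> quarter_plane_walks S n.
             vertex w n = (int k, int l) \<and> horizontal_visits w = h \<and> vertical_visits w = v}"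

text \<open>Cutting off the inner sums of the generating function at \<open>h, v \<le> n\<close> loses nothing.\<close>

lemma num_walks_eq_0:
  assumes "h > n \<or> v > n"
  shows "num_walks S n k l h v = 0"
proof -
  have bound: "card {i \<in> {1..m}. P i} \<le> m" for m and P :: "nat \<Rightarrow> bool"
  proof -
    have "card {i \<in> {1..m}. P i} \<le> card {1..m}"
      by (rule card_mono) auto
    thus ?thesis by simp
  qed
  have "horizontal_visits w \<le> n \<and> vertical_visits w \<le> n" if "w \<in> quarter_plane_walks S n" for w
    using that bound[of "length w"]
    by (auto simp: quarter_plane_walks_def horizontal_visits_def vertical_visits_def)
  hence "{w \<in> quarter_plane_walks S n. vertex w n = (int k, int l) \<and>
           horizontal_visits w = h \<and> vertical_visits w = v} = {}"
    using assms by force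
  thus ?thesis
    unfolding num_walks_def by (simp only: card.empty)
qed

text \<open>The weights \<open>a\<close>, \<open>b\<close> are elements of an arbitrary commutative ring: taking them to be
  indeterminates gives \<open>G(t;a,b)\<close> itself, other values give its specializations.\<close>

definition excursion_gf :: "step set \<Rightarrow> 'a::comm_ring_1 \<Rightarrow> 'a \<Rightarrow> 'a fps" where
  "excursion_gf S a b =
     Abs_fps (\<lambda>n. \<Sum>h\<le>n. \<Sum>v\<le>n. of_nat (num_walks S n 0 0 h v) * a ^ h * b ^ v)"

definition D_finite :: "'a::field fps \<Rightarrow> bool" where
  "D_finite F \<longleftrightarrow>
     (\<exists>(r::nat) (p :: nat \<Rightarrow> 'a poly). (\<exists>i\<le>r. p i \<noteq> 0) \<and>
        (\<Sum>i\<le>r. fps_of_poly (p i) * (fps_deriv ^^ i) F) = 0)"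

text \<open>The quotient is taken in the field of formal Laurent series, since division of formal power
  series is only a truncated division.\<close>

definition ratio_of_D_finite :: "'a::field fps \<Rightarrow> bool" where
  "ratio_of_D_finite G \<longleftrightarrow>
     (\<exists>F H. D_finite F \<and> D_finite H \<and> H \<noteq> 0 \<and>
        fps_to_fls G = fps_to_fls F / fps_to_fls H)"

text \<open>\<open>\<rat>(x)\<close> with its indeterminate, and \<open>\<rat>(a,b)\<close>, the fraction field of \<open>\<rat>[a][b]\<close>,
  with its two indeterminates.\<close>

type_synonym rat_fun1 = "rat poly fract"
type_synonym rat_fun2 = "rat poly poly fract"

definition indet :: rat_fun1 where
  "indet = to_fract [:0, 1:]"

definition indet_a :: rat_fun2 where
  "indet_a = to_fract [:[:0, 1:]:]"

definition indet_b :: rat_fun2 where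
  "indet_b = to_fract [:0, 1:]"

definition model17 :: "step set" where
  "model17 = {(0, 1), (-1, 0), (1, -1)}"

definition model18 :: "step set" where
  "model18 = {(1, 0), (-1, 0), (0, 1), (0, -1), (1, -1), (-1, 1)}"

end

theory Submission
  imports Defs
begin

unbundle fps_syntax

text \<open>Let \<open>c = 1/(ab) - \<alpha>\<beta>G\<close> with \<open>\<alpha> = 1 - 1/a\<close> and \<open>\<beta> = 1 - 1/b\<close>. In the kernel equation the only
  inhomogeneous term is \<open>c\<close>. Evaluated at the small root \<open>Y\<close> of the kernel and at two more points of
  its orbit, it becomes, after elimination, a relation \<open>p Q(x,0) + q Q(0,1/x) = - c E\<close> in which \<open>p\<close>
  and \<open>q\<close> are Laurent polynomials and \<open>E\<close> is algebraic. \<open>Q(x,0)\<close> contains no negative and \<open>Q(0,1/x)\<close>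
  no positive powers of \<open>x\<close>. For Model 18 extracting the coefficients of \<open>x\<^sup>0\<close> and \<open>x\<^sup>1\<close> suffices. For
  Model 17 the constant term gives a tautology; instead one divides first by the Wiener-Hopf factor
  \<open>1 - z/x\<close> of \<open>p\<close>, where \<open>z\<close> is the small root of \<open>p\<close>. The result is a linear equation for \<open>G\<close> whose
  coefficients are constant terms of algebraic series in \<open>K((x))[[t]]\<close>. Such constant terms are
  D-finite, by a dimension count.\<close>

section \<open>Bivariate series\<close>

text \<open>In Model 17 the origin is entered only from (1,0), so G = 1 + a b t [x^1] Q(x,0). With
  this, the constant term of the relation becomes the equation [x^0] E = \<alpha> multiplied by c,
  and says nothing about G. Dividing by 1 - z/x first removes [x^1] Q(x,0): the cofactor of 1 - z/x
  in p is a polynomial in x, and 1/(1 - z/x) brings only nonpositive powers into the term with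
  Q(0,1/x). The elimination works because in both models the second kernel root is x/Y: t x/Y is
  conjugate to t Y, and symmetric expressions in the two are rational in x and t. In Model 17 the
  irrational factor \<beta> - \<omega> is common to the coefficients of both unknown series. In
  Model 18 one coefficient carries \<alpha> - \<omega> and the other \<beta> - \<omega>; they can be
  divided out together when b = a, hence the restriction to G(t;a,a). The algebraic series that
  occur are built from a few square roots over K(x,t). A product of square roots satisfies
  first-order equations in x and in t, and the dimension count is done for sums of such series,
  where the growth of degrees under differentiation is explicit.\<close>

text \<open>The ambient ring is \<open>K((x))[[t]]\<close>, realised as \<open>'a fls fps\<close>.\<close>

definition fps_embed :: "'a::comm_ring_1 fps \<Rightarrow> 'a fls fps" where
  "fps_embed f = Abs_fps (\<lambda>n. fls_const (f $ n))"

definition x_coeff :: "int \<Rightarrow> 'a::comm_ring_1 fls fps \<Rightarrow> 'a fps" where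
  "x_coeff k f = Abs_fps (\<lambda>n. f $ n $$ k)"

definition x_deriv :: "'a::comm_ring_1 fls fps \<Rightarrow> 'a fls fps" where
  "x_deriv f = Abs_fps (\<lambda>n. fls_deriv (f $ n))"

definition xvar :: "'a::comm_ring_1 fls fps" where "xvar = fps_const fls_X"
definition xinv :: "'a::comm_ring_1 fls fps" where "xinv = fps_const fls_X_inv"

lemma fps_embed_nth [simp]: "fps_embed f $ n = fls_const (f $ n)"
  by (simp add: fps_embed_def)

lemma x_coeff_nth [simp]: "x_coeff k f $ n = f $ n $$ k"
  by (simp add: x_coeff_def)

lemma x_deriv_nth [simp]: "x_deriv f $ n = fls_deriv (f $ n)"
  by (simp add: x_deriv_def)

lemma xvar_xinv [simp]: "xvar * xinv = (1 :: 'a::comm_ring_1 fls fps)"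
proof -
  have "fls_X * fls_X_inv = (1 :: 'a fls)"
    by (rule fls_eqI) (simp add: fls_X_times_conv_shift)
  thus ?thesis by (simp add: xvar_def xinv_def)
qed

lemma xvar_neq_0 [simp]: "xvar \<noteq> (0 :: 'a::comm_ring_1 fls fps)"
  and xinv_neq_0 [simp]: "xinv \<noteq> (0 :: 'a::comm_ring_1 fls fps)"
  using xvar_xinv by (metis mult_zero_left mult_zero_right zero_neq_one)+

lemma fls_const_sum: "fls_const (sum f A) = (\<Sum>x\<in>A. fls_const (f x :: 'a::comm_ring_1))"
  by (induction A rule: infinite_finite_induct) (auto simp flip: fls_plus_const)

lemma fls_nth_sum: "sum f A $$ k = (\<Sum>x\<in>A. f x $$ k)"
  by (induction A rule: infinite_finite_induct) auto

lemma fps_embed_0 [simp]: "fps_embed 0 = 0"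
  and fps_embed_1 [simp]: "fps_embed 1 = 1"
  and fps_embed_X [simp]: "fps_embed fps_X = fps_X"
  and fps_embed_const: "fps_embed (fps_const c) = fps_const (fls_const c)"
  by (auto intro!: fps_ext)

lemma fps_embed_add: "fps_embed (f + g) = fps_embed f + fps_embed g"
  and fps_embed_diff: "fps_embed (f - g) = fps_embed f - fps_embed g"
  and fps_embed_uminus: "fps_embed (- f) = - fps_embed f"
  by (auto intro!: fps_ext simp: fls_plus_const fls_minus_const)

lemma fps_embed_mult: "fps_embed (f * g) = fps_embed f * fps_embed g"
  by (rule fps_ext) (simp add: fps_mult_nth fls_const_sum flip: fls_const_mult_const)

lemma fps_embed_power: "fps_embed (f ^ n) = fps_embed f ^ n"
  by (induction n) (auto simp: fps_embed_mult)

lemma fps_embed_inj: "fps_embed f = fps_embed g \<Longrightarrow> f = g"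
  by (metis fps_embed_nth fps_ext fls_const_nth)

lemma x_coeff_0 [simp]: "x_coeff k 0 = 0"
  by (rule fps_ext) simp

lemma x_coeff_add: "x_coeff k (f + g) = x_coeff k f + x_coeff k g"
  and x_coeff_diff: "x_coeff k (f - g) = x_coeff k f - x_coeff k g"
  and x_coeff_uminus: "x_coeff k (- f) = - x_coeff k f"
  by (auto intro!: fps_ext)

lemma x_coeff_sum: "x_coeff k (sum f A) = (\<Sum>i\<in>A. x_coeff k (f i))"
  by (induction A rule: infinite_finite_induct) (auto simp: x_coeff_add)

lemma x_coeff_embed_mult: "x_coeff k (fps_embed c * f) = c * x_coeff k f"
  by (rule fps_ext) (simp add: fps_mult_nth fls_nth_sum)

lemma x_coeff_embed: "x_coeff k (fps_embed c) = (if k = 0 then c else 0)"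
  by (rule fps_ext) simp

lemma x_coeff_xvar_mult: "x_coeff k (xvar * f) = x_coeff (k - 1) f"
  by (rule fps_ext) (simp add: xvar_def fls_X_times_conv_shift)

lemma x_coeff_xinv_mult: "x_coeff k (xinv * f) = x_coeff (k + 1) f"
  by (rule fps_ext) (simp add: xinv_def fls_X_inv_times_conv_shift)

lemma x_deriv_0 [simp]: "x_deriv 0 = 0"
  by (rule fps_ext) simp

lemma x_deriv_add: "x_deriv (f + g) = x_deriv f + x_deriv g"
  by (rule fps_ext) simp

lemma x_deriv_mult: "x_deriv (f * g) = x_deriv f * g + f * x_deriv g"
  by (rule fps_ext) (simp only: fps_mult_nth fls_deriv_sum sum.distrib fls_deriv_mult x_deriv_nth fps_add_nth add.commute)

lemma x_deriv_embed [simp]: "x_deriv (fps_embed f) = 0"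
  by (rule fps_ext) simp

lemma x_deriv_xvar [simp]: "x_deriv xvar = 1"
  by (rule fps_ext) (auto simp: xvar_def)

lemma fps_deriv_xvar [simp]: "fps_deriv xvar = 0"
  by (simp add: xvar_def)

lemma fps_deriv_embed: "fps_deriv (fps_embed f) = fps_embed (fps_deriv f)"
  by (rule fps_ext) (simp add: fls_of_nat flip: fls_const_mult_const fls_plus_const)

lemma x_coeff_fps_deriv: "x_coeff k (fps_deriv f) = fps_deriv (x_coeff k f)"
  by (rule fps_ext) (simp add: fls_of_nat algebra_simps)

lemma x_coeff_fps_deriv_iter: "x_coeff k ((fps_deriv ^^ i) f) = (fps_deriv ^^ i) (x_coeff k f)"
  by (induction i) (auto simp: x_coeff_fps_deriv)

lemma x_coeff_x_deriv: "x_coeff k (x_deriv f) = fps_const (of_int (k + 1)) * x_coeff (k + 1) f"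
  by (rule fps_ext) (simp only: x_coeff_nth x_deriv_nth fls_deriv_nth fps_mult_left_const_nth)

section \<open>Polynomials inside the ring of bivariate series\<close>

text \<open>The outer variable becomes x and the inner one t. So \<open>degree\<close> measures the
  degree in x, with K[t] as coefficient ring; the dimension count bounds only this degree.\<close>

definition poly_embed :: "'a::comm_ring_1 poly poly \<Rightarrow> 'a fls fps" where
  "poly_embed P = poly (map_poly (\<lambda>p. fps_embed (fps_of_poly p)) P) xvar"

lemma poly_embed_pCons [simp]:
  "poly_embed (pCons p P) = fps_embed (fps_of_poly p) + xvar * poly_embed P"
  by (simp add: poly_embed_def map_poly_pCons)

lemma poly_embed_0 [simp]: "poly_embed 0 = 0"
  by (simp add: poly_embed_def)

lemma poly_embed_1 [simp]: "poly_embed 1 = 1"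
  by (simp add: one_pCons)

lemma poly_embed_add: "poly_embed (P + Q) = poly_embed P + poly_embed Q"
  by (induction P Q rule: poly_induct2) (auto simp: fps_of_poly_add fps_embed_add algebra_simps)

lemma poly_embed_smult: "poly_embed (smult p P) = fps_embed (fps_of_poly p) * poly_embed P"
  by (induction P) (auto simp: fps_of_poly_mult fps_embed_mult algebra_simps)

lemma poly_embed_mult: "poly_embed (P * Q) = poly_embed P * poly_embed Q"
  by (induction P) (auto simp: poly_embed_add poly_embed_smult algebra_simps)

lemma poly_embed_uminus: "poly_embed (- P) = - poly_embed P"
  using poly_embed_smult[of "-1" P] by (simp add: fps_of_poly_uminus fps_embed_uminus)

lemma poly_embed_diff: "poly_embed (P - Q) = poly_embed P - poly_embed Q"
  using poly_embed_add[of P "- Q"] by (simp add: poly_embed_uminus)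

lemma poly_embed_sum: "poly_embed (sum f A) = (\<Sum>i\<in>A. poly_embed (f i))"
  by (induction A rule: infinite_finite_induct) (auto simp: poly_embed_add)

lemma poly_embed_of_nat: "poly_embed (of_nat n) = of_nat n"
  by (induction n) (auto simp: poly_embed_add)

lemma x_deriv_poly_embed: "x_deriv (poly_embed P) = poly_embed (pderiv P)"
  by (induction P) (auto simp: x_deriv_add x_deriv_mult poly_embed_add pderiv_pCons)

lemma fps_deriv_poly_embed: "fps_deriv (poly_embed P) = poly_embed (map_poly pderiv P)"
  by (induction P)
     (auto simp: map_poly_pCons fps_deriv_embed fps_of_poly_pderiv)

definition is_poly :: "'a::comm_ring_1 fls fps \<Rightarrow> bool" where
  "is_poly f \<longleftrightarrow> (\<exists>P. f = poly_embed P)"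

named_theorems poly_intros

lemma is_poly_embed [poly_intros]: "is_poly (poly_embed P)"
  by (auto simp: is_poly_def)

lemma is_poly_0 [poly_intros]: "is_poly 0"
  unfolding is_poly_def by (rule exI[of _ 0]) simp

lemma is_poly_1 [poly_intros]: "is_poly 1"
  unfolding is_poly_def by (rule exI[of _ 1]) simp

lemma is_poly_add [poly_intros]: "is_poly f \<Longrightarrow> is_poly g \<Longrightarrow> is_poly (f + g)"
  unfolding is_poly_def by (metis poly_embed_add)

lemma is_poly_diff [poly_intros]: "is_poly f \<Longrightarrow> is_poly g \<Longrightarrow> is_poly (f - g)"
  unfolding is_poly_def by (metis poly_embed_diff)

lemma is_poly_uminus [poly_intros]: "is_poly f \<Longrightarrow> is_poly (- f)"
  unfolding is_poly_def by (metis poly_embed_uminus)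

lemma is_poly_mult [poly_intros]: "is_poly f \<Longrightarrow> is_poly g \<Longrightarrow> is_poly (f * g)"
  unfolding is_poly_def by (metis poly_embed_mult)

lemma is_poly_power [poly_intros]: "is_poly f \<Longrightarrow> is_poly (f ^ n)"
  by (induction n) (auto intro: poly_intros)

lemma is_poly_xvar [poly_intros]: "is_poly xvar"
  unfolding is_poly_def by (rule exI[of _ "[:0, 1:]"]) simp

lemma is_poly_fps_X [poly_intros]: "is_poly fps_X"
  unfolding is_poly_def by (rule exI[of _ "[:[:0, 1:]:]"]) (simp add: fps_of_poly_pCons)

lemma is_poly_const [poly_intros]: "is_poly (fps_const (fls_const c))"
  unfolding is_poly_def
  by (rule exI[of _ "[:[:c:]:]"]) (simp add: fps_embed_const fps_of_poly_pCons)

lemma is_poly_numeral [poly_intros]: "is_poly (numeral n)"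
proof -
  have "fps_const (fls_const (numeral n)) = (numeral n :: 'a fls fps)"
    by (metis fls_const_numeral numeral_fps_const)
  thus ?thesis by (metis is_poly_const)
qed

lemma is_poly_fps_deriv [poly_intros]:
  fixes f :: "'a::idom fls fps"
  shows "is_poly f \<Longrightarrow> is_poly (fps_deriv f)"
  by (auto simp: is_poly_def fps_deriv_poly_embed)

lemma is_poly_x_deriv [poly_intros]:
  fixes f :: "'a::idom fls fps"
  shows "is_poly f \<Longrightarrow> is_poly (x_deriv f)"
  by (auto simp: is_poly_def x_deriv_poly_embed)

section \<open>D-finiteness of residues\<close>

text \<open>Gaussian elimination by cross-multiplication never divides. It therefore works over K[t]
  itself and yields polynomial coefficients for the differential operator.\<close>

lemma homogeneous_system_nontrivial_solution:
  fixes A :: "'i \<Rightarrow> 'j \<Rightarrow> 'r::idom"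
  assumes "finite I" "finite J" "card I < card J"
  shows "\<exists>v. (\<exists>j\<in>J. v j \<noteq> 0) \<and> (\<forall>i\<in>I. (\<Sum>j\<in>J. A i j * v j) = 0)"
  using assms
proof (induction I arbitrary: J A rule: finite_induct)
  case empty
  then obtain j where "j \<in> J" by fastforce
  thus ?case by (intro exI[of _ "\<lambda>_. 1"]) auto
next
  case (insert i0 I J A)
  show ?case
  proof (cases "\<forall>j\<in>J. A i0 j = 0")
    case True
    have "card I < card J"
      using insert.prems insert.hyps by simp
    with insert.IH[OF \<open>finite J\<close> this, of A] obtain v where
      "\<exists>j\<in>J. v j \<noteq> 0" "\<forall>i\<in>I. (\<Sum>j\<in>J. A i j * v j) = 0"
      by blast
    with True show ?thesis by (intro exI[of _ v]) auto
  next
    case False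
    then obtain j0 where j0: "j0 \<in> J" "A i0 j0 \<noteq> 0" by blast
    define J' where "J' = J - {j0}"
    have J: "J = insert j0 J'" "j0 \<notin> J'" "finite J'"
      using j0 insert.prems by (auto simp: J'_def)
    have "card I < card J'"
      using insert.prems insert.hyps J by simp
    then obtain w where w: "\<exists>j\<in>J'. w j \<noteq> 0"
      "\<forall>i\<in>I. (\<Sum>j\<in>J'. (A i0 j0 * A i j - A i j0 * A i0 j) * w j) = 0"
      using insert.IH[of J' "\<lambda>i j. A i0 j0 * A i j - A i j0 * A i0 j"] J by blast
    define v where "v = (\<lambda>j. if j = j0 then - (\<Sum>j\<in>J'. A i0 j * w j) else A i0 j0 * w j)"
    have sum_v: "(\<Sum>j\<in>J. A i j * v j) =
        - A i j0 * (\<Sum>j\<in>J'. A i0 j * w j) + A i0 j0 * (\<Sum>j\<in>J'. A i j * w j)" for i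
    proof -
      have "(\<Sum>j\<in>J'. A i j * v j) = (\<Sum>j\<in>J'. A i0 j0 * (A i j * w j))"
        using J by (intro sum.cong) (auto simp: v_def)
      thus ?thesis
        using J by (simp add: v_def sum_distrib_left sum_negf)
    qed
    have "(\<Sum>j\<in>J. A i j * v j) = 0" if "i \<in> insert i0 I" for i
    proof (cases "i = i0")
      case False
      with that w(2) have "(\<Sum>j\<in>J'. (A i0 j0 * A i j - A i j0 * A i0 j) * w j) = 0"
        by auto
      thus ?thesis
        unfolding sum_v by (simp add: algebra_simps sum_subtractf sum_negf sum_distrib_left)
    qed (simp add: sum_v)
    moreover have "\<exists>j\<in>J. v j \<noteq> 0"
      using w(1) J j0 by (auto simp: v_def)
    ultimately show ?thesis by blast
  qed
qed

text \<open>Quotient rule: D^(n+2) u' = D (D^(n+1) u)' - (n+1) D' D^(n+1) u. One differentiation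
  costs one factor D and raises the x-degree of the coefficients by at most d. The abstract
  derivation \<open>dd\<close> covers both the t- and the x-derivative.\<close>

lemma iterated_derivation_step:
  fixes f :: "'a::comm_ring_1 fls fps" and h :: "nat \<Rightarrow> 'a fls fps"
  assumes der: "\<And>f g. dd (f + g) = dd f + dd g" "\<And>f g. dd (f * g) = dd f * g + f * dd g"
    and der_poly: "\<And>P. dd (poly_embed P) = poly_embed (dp P)" "\<And>P. degree (dp P) \<le> degree P"
    and h: "\<And>k. k < s \<Longrightarrow> poly_embed D * dd (h k) = poly_embed (M k) * h k"
    and deg: "degree D \<le> d" "\<And>k. k < s \<Longrightarrow> degree (M k) \<le> d"
    and u: "poly_embed D ^ Suc n * u = (\<Sum>k<s. poly_embed (P k) * h k)"
      "\<And>k. k < s \<Longrightarrow> degree (P k) \<le> d * n"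
  shows "\<exists>P'. (\<forall>k<s. degree (P' k) \<le> d * Suc n) \<and>
    poly_embed D ^ Suc (Suc n) * dd u = (\<Sum>k<s. poly_embed (P' k) * h k)"
proof -
  let ?D = "poly_embed D"
  define P' where "P' = (\<lambda>k. D * dp (P k) + P k * M k - of_nat (Suc n) * (dp D * P k))"
  have der_0: "dd 0 = 0" using der(1)[of 0 0] by simp
  have der_1: "dd 1 = 0" using der(2)[of 1 1] by simp
  have der_sum: "dd (sum g A) = (\<Sum>k\<in>A. dd (g k))" for g and A :: "nat set"
    by (induction A rule: infinite_finite_induct) (auto simp: der_0 der)
  have der_power: "dd (?D ^ m) * ?D = of_nat m * (?D ^ m * dd ?D)" for m
    by (induction m) (auto simp: der_1 der algebra_simps)
  have "?D * dd (?D ^ Suc n * u) = of_nat (Suc n) * dd ?D * (?D ^ Suc n * u) + ?D ^ Suc (Suc n) * dd u"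
    using der_power[of "Suc n"] by (simp add: der algebra_simps)
  hence "?D ^ Suc (Suc n) * dd u =
      ?D * dd (?D ^ Suc n * u) - of_nat (Suc n) * dd ?D * (?D ^ Suc n * u)"
    by simp
  also have "\<dots> = (\<Sum>k<s. ?D * dd (poly_embed (P k) * h k)
                     - of_nat (Suc n) * dd ?D * (poly_embed (P k) * h k))"
    unfolding u(1) der_sum by (simp add: sum_distrib_left sum_subtractf)
  also have "\<dots> = (\<Sum>k<s. poly_embed (P' k) * h k)"
  proof (intro sum.cong refl)
    fix k assume k: "k \<in> {..<s}"
    have "?D * dd (poly_embed (P k) * h k) =
        ?D * poly_embed (dp (P k)) * h k + poly_embed (P k) * (?D * dd (h k))"
      by (simp add: der der_poly algebra_simps)
    also have "\<dots> = (?D * poly_embed (dp (P k)) + poly_embed (P k) * poly_embed (M k)) * h k"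
      using h k by (simp add: algebra_simps)
    finally show "?D * dd (poly_embed (P k) * h k)
        - of_nat (Suc n) * dd ?D * (poly_embed (P k) * h k) = poly_embed (P' k) * h k"
      unfolding P'_def poly_embed_diff poly_embed_add poly_embed_mult poly_embed_of_nat der_poly
      by (simp only: algebra_simps)
  qed
  finally have "?D ^ Suc (Suc n) * dd u = (\<Sum>k<s. poly_embed (P' k) * h k)" .
  moreover have "degree (P' k) \<le> d * Suc n" if "k < s" for k
  proof -
    have "degree (A * B) \<le> d * Suc n"
      if "degree A \<le> d" "degree B \<le> d * n" for A B :: "'a poly poly"
      using degree_mult_le[of A B] that by simp
    note * = this
    have 1: "degree (D * dp (P k)) \<le> d * Suc n"
      using deg(1) u(2)[OF that] der_poly(2)[of "P k"] by (intro *) auto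
    have 2: "degree (P k * M k) \<le> d * Suc n"
      using deg(2)[OF that] u(2)[OF that] by (subst mult.commute, intro *) auto
    have 3: "degree (dp D * P k) \<le> d * Suc n"
      using deg(1) u(2)[OF that] der_poly(2)[of D] by (intro *) auto
    have "degree (of_nat (Suc n) * (dp D * P k)) \<le> d * Suc n"
      using degree_mult_le[of "of_nat (Suc n)" "dp D * P k"] 3 by (simp only: degree_of_nat)
    with 1 2 show ?thesis
      unfolding P'_def by (intro degree_diff_le degree_add_le)
  qed
  ultimately show ?thesis by blast
qed

lemma degree_map_poly_pderiv_le: "degree (map_poly pderiv P) \<le> degree P"
  by (rule degree_le) (simp add: coeff_map_poly coeff_eq_0)

text \<open>The \<open>(N + 1)\<^sup>2\<close> operators \<open>\<partial>\<^sub>x\<^sup>j \<partial>\<^sub>t\<^sup>i\<close> with \<open>i, j \<le> N\<close> map \<open>f\<close> into a \<open>K(t)\<close>-space whose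
  dimension grows only linearly in \<open>N\<close>, so some combination of them with coefficients in
  \<open>K[t]\<close> annihilates \<open>f\<close>. Taking residues in \<open>x\<close> removes everything but the terms of least
  order in \<open>\<partial>\<^sub>x\<close>.\<close>

lemma residue_D_finite:
  fixes f :: "'a::field_char_0 fls fps" and h :: "nat \<Rightarrow> 'a fls fps"
  assumes D: "poly_embed D \<noteq> 0"
    and ht: "\<And>k. k < s \<Longrightarrow> poly_embed D * fps_deriv (h k) = poly_embed (M k) * h k"
    and hx: "\<And>k. k < s \<Longrightarrow> poly_embed D * x_deriv (h k) = poly_embed (N k) * h k"
    and f: "poly_embed D * f = (\<Sum>k<s. h k)"
  shows "D_finite (x_coeff (-1) f)"
proof -
  define d where "d = degree D + (\<Sum>k<s. degree (M k) + degree (N k))"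
  have "degree (M k) + degree (N k) \<le> (\<Sum>k<s. degree (M k) + degree (N k))" if "k < s" for k
    using that by (intro member_le_sum) auto
  hence deg: "degree D \<le> d" "\<And>k. k < s \<Longrightarrow> degree (M k) \<le> d" "\<And>k. k < s \<Longrightarrow> degree (N k) \<le> d"
    unfolding d_def by (force intro: add_increasing)+
  define op where "op = (\<lambda>(i, j). (x_deriv ^^ j) ((fps_deriv ^^ i) f))"
  have "\<exists>P. (\<forall>k<s. degree (P k) \<le> d * (i + j)) \<and>
          poly_embed D ^ Suc (i + j) * op (i, j) = (\<Sum>k<s. poly_embed (P k) * h k)" for i j
  proof (induction j)
    case 0
    show ?case
    proof (induction i)
      case 0
      show ?case by (intro exI[of _ "\<lambda>_. 1"]) (auto simp: op_def f)
    next
      case (Suc i)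
      then obtain P where P: "\<forall>k<s. degree (P k) \<le> d * (i + 0)"
        "poly_embed D ^ Suc (i + 0) * op (i, 0) = (\<Sum>k<s. poly_embed (P k) * h k)"
        by blast
      show ?case
        using iterated_derivation_step[where dd = fps_deriv and dp = "map_poly pderiv", OF _ _
            fps_deriv_poly_embed degree_map_poly_pderiv_le ht deg(1,2) P(2)] P(1)
        by (simp add: op_def)
    qed
  next
    case (Suc j)
    then obtain P where P: "\<forall>k<s. degree (P k) \<le> d * (i + j)"
      "poly_embed D ^ Suc (i + j) * op (i, j) = (\<Sum>k<s. poly_embed (P k) * h k)"
      by blast
    have "degree (pderiv P) \<le> degree P" for P :: "'a poly poly"
      by (simp add: degree_pderiv)
    from iterated_derivation_step[where dd = x_deriv and dp = pderiv, OF x_deriv_add x_deriv_mult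
        x_deriv_poly_embed this hx deg(1,3) P(2)] P(1)
    show ?case by (simp add: op_def)
  qed
  then obtain P where P: "\<And>i j k. k < s \<Longrightarrow> degree (P i j k) \<le> d * (i + j)"
    "\<And>i j. poly_embed D ^ Suc (i + j) * op (i, j) = (\<Sum>k<s. poly_embed (P i j k) * h k)"
    by metis
  \<comment> \<open>With this B the s (2 d B + 1) linear conditions number at most B^2 + s, fewer
    than the (B + 1)^2 operators.\<close>
  define B where "B = s * (2 * d + 1)"
  define J where "J = {..B} \<times> {..B}"
  define I where "I = {..<s} \<times> {..2 * d * B}"
  \<comment> \<open>The extra power of D gives all operators the same denominator D^(2B+1), so that
    one degree bound serves for all.\<close>
  define P' where "P' = (\<lambda>(i, j) k. D ^ (2 * B - (i + j)) * P i j k)"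
  have P'_deg: "degree (P' ij k) \<le> 2 * d * B" if "ij \<in> J" "k < s" for ij k
  proof -
    obtain i j where "ij = (i, j)" by (cases ij)
    with that(1) have ij: "ij = (i, j)" "i \<le> B" "j \<le> B"
      by (auto simp: J_def)
    have "degree (P' ij k) \<le> degree D * (2 * B - (i + j)) + degree (P i j k)"
      unfolding P'_def ij using degree_mult_le[of "D ^ (2 * B - (i + j))" "P i j k"]
        degree_power_le[of D "2 * B - (i + j)"] by simp
    also have "\<dots> \<le> d * (2 * B - (i + j)) + d * (i + j)"
      using deg(1) P(1)[OF that(2)] by (intro add_mono mult_right_mono) auto
    also have "\<dots> = d * (2 * B)"
      using ij by (simp flip: add_mult_distrib2)
    finally show ?thesis by simp
  qed
  have P'_op: "poly_embed D ^ Suc (2 * B) * op ij = (\<Sum>k<s. poly_embed (P' ij k) * h k)"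
    if "ij \<in> J" for ij
  proof -
    obtain i j where "ij = (i, j)" by (cases ij)
    with that have ij: "ij = (i, j)" "i + j \<le> 2 * B"
      by (auto simp: J_def)
    have pow: "poly_embed (A ^ n) = poly_embed A ^ n" for A :: "'a poly poly" and n
      by (induction n) (auto simp: poly_embed_mult)
    have "poly_embed D ^ Suc (2 * B) * op ij =
        poly_embed D ^ (2 * B - (i + j)) * (poly_embed D ^ Suc (i + j) * op (i, j))"
      using ij by (simp add: algebra_simps flip: power_add)
    thus ?thesis
      unfolding P(2) by (simp add: ij P'_def sum_distrib_left sum_distrib_right poly_embed_mult pow mult_ac)
  qed
  have "card I < card J"
  proof -
    have "card I = s * (2 * d * B + 1)" and J: "card J = (B + 1) * (B + 1)"
      by (auto simp: I_def J_def)
    moreover have "s * (2 * d * B + 1) \<le> B * B + s"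
      unfolding B_def by (simp add: algebra_simps)
    moreover have "s \<le> B" by (simp add: B_def)
    moreover have "(B + 1) * (B + 1) = B * B + 2 * B + 1" by simp
    ultimately show ?thesis by linarith
  qed
  then obtain c where c: "\<exists>ij\<in>J. c ij \<noteq> (0 :: 'a poly)"
    "\<forall>km\<in>I. (\<Sum>ij\<in>J. coeff (P' ij (fst km)) (snd km) * c ij) = 0"
    using homogeneous_system_nontrivial_solution[of I J
        "\<lambda>km ij. coeff (P' ij (fst km)) (snd km)"] by (auto simp: I_def J_def)
  have comb: "(\<Sum>ij\<in>J. smult (c ij) (P' ij k)) = 0" if k: "k < s" for k
  proof (rule poly_eqI)
    fix m
    show "coeff (\<Sum>ij\<in>J. smult (c ij) (P' ij k)) m = coeff 0 m"
    proof (cases "m \<le> 2 * d * B")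
      case True
      with c(2) k have "(\<Sum>ij\<in>J. coeff (P' ij k) m * c ij) = 0"
        unfolding I_def by force
      thus ?thesis by (simp add: coeff_sum mult.commute)
    next
      case False
      hence "coeff (P' ij k) m = 0" if "ij \<in> J" for ij
        using P'_deg[OF that k] by (intro coeff_eq_0) simp
      thus ?thesis by (simp add: coeff_sum)
    qed
  qed
  let ?e = "\<lambda>ij. fps_embed (fps_of_poly (c ij))"
  have "poly_embed D ^ Suc (2 * B) * (\<Sum>ij\<in>J. ?e ij * op ij) =
      (\<Sum>ij\<in>J. ?e ij * (poly_embed D ^ Suc (2 * B) * op ij))"
    by (simp add: sum_distrib_left mult_ac)
  also have "\<dots> = (\<Sum>ij\<in>J. \<Sum>k<s. poly_embed (smult (c ij) (P' ij k)) * h k)"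
    by (intro sum.cong refl) (simp only: P'_op, simp add: sum_distrib_left poly_embed_smult mult_ac)
  also have "\<dots> = (\<Sum>k<s. poly_embed (\<Sum>ij\<in>J. smult (c ij) (P' ij k)) * h k)"
    by (subst sum.swap) (simp add: sum_distrib_right poly_embed_sum)
  also have "\<dots> = 0" by (simp add: comb)
  finally have ann: "(\<Sum>ij\<in>J. ?e ij * op ij) = 0"
    using D by simp
  define j0 where "j0 = (LEAST j. \<exists>i\<le>B. j \<le> B \<and> c (i, j) \<noteq> 0)"
  from c(1) have "\<exists>j. \<exists>i\<le>B. j \<le> B \<and> c (i, j) \<noteq> 0"
    by (auto simp: J_def)
  hence "\<exists>i\<le>B. j0 \<le> B \<and> c (i, j0) \<noteq> 0"
    unfolding j0_def by (rule LeastI_ex)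
  then obtain i0 where i0: "i0 \<le> B" "j0 \<le> B" "c (i0, j0) \<noteq> 0" by blast
  have least: "c (i, j) = 0" if "j < j0" "i \<le> B" for i j
    using not_less_Least[of j "\<lambda>j. \<exists>i\<le>B. j \<le> B \<and> c (i, j) \<noteq> 0"] that i0(2)
    unfolding j0_def by auto
  have iter: "(x_deriv ^^ n) (fps_embed e * g) = fps_embed e * (x_deriv ^^ n) g"
    for n and e :: "'a fps" and g
    by (induction n) (auto simp: x_deriv_mult)
  have iter_add: "(x_deriv ^^ n) (g + g') = (x_deriv ^^ n) g + (x_deriv ^^ n) g'" for n and g g' :: "'a fls fps"
    by (induction n) (auto simp: x_deriv_add)
  have iter_0: "(x_deriv ^^ n) (0 :: 'a fls fps) = 0" for n
    by (induction n) auto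
  have iter_sum: "(x_deriv ^^ n) (sum g A) = (\<Sum>a\<in>A. (x_deriv ^^ n) (g a))"
    for n and g :: "nat \<times> nat \<Rightarrow> 'a fls fps" and A
    by (induction A rule: infinite_finite_induct) (auto simp: iter_add iter_0)
  \<comment> \<open>The coefficients \<open>c\<close> are free of x, so the j0-th x-derivative can
    be pulled out of the annihilating combination; F is what remains inside. F itself may be
    nonzero, but its residue vanishes.\<close>
  define F where "F = (\<Sum>(i, j)\<in>{..B} \<times> {j0..B}. ?e (i, j) * op (i, j - j0))"
  have "(x_deriv ^^ j0) F = (\<Sum>ij\<in>{..B} \<times> {j0..B}. ?e ij * op ij)"
    unfolding F_def iter_sum
  proof (intro sum.cong refl)
    fix ij assume "ij \<in> {..B} \<times> {j0..B}"
    then obtain i j where ij: "ij = (i, j)" "j \<ge> j0" by auto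
    have "x_deriv ^^ j = x_deriv ^^ j0 \<circ> x_deriv ^^ (j - j0)"
      using ij(2) by (simp flip: funpow_add)
    hence "(x_deriv ^^ j0) (op (i, j - j0)) = op (i, j)"
      unfolding op_def prod.case by (metis comp_apply)
    thus "(x_deriv ^^ j0) (case ij of (i, j) \<Rightarrow> ?e (i, j) * op (i, j - j0)) = ?e ij * op ij"
      by (simp add: ij(1) iter)
  qed
  also have "\<dots> = (\<Sum>ij\<in>J. ?e ij * op ij)"
  proof (rule sum.mono_neutral_left)
    show "\<forall>ij\<in>J - {..B} \<times> {j0..B}. ?e ij * op ij = 0"
    proof
      fix ij assume ij: "ij \<in> J - {..B} \<times> {j0..B}"
      hence "c ij = 0" using least[of "snd ij" "fst ij"]
        by (cases "snd ij < j0") (auto simp: J_def)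
      thus "?e ij * op ij = 0" by simp
    qed
  qed (auto simp: J_def)
  finally have F: "(x_deriv ^^ j0) F = 0" by (simp only: ann)
  \<comment> \<open>The constant r is (-1)^n n!, nonzero in characteristic 0: repeated
    differentiation never kills the term in 1/x.\<close>
  have "\<exists>r::'a. r \<noteq> 0 \<and> (\<forall>g. x_coeff (- 1 - int n) ((x_deriv ^^ n) g) = fps_const r * x_coeff (-1) g)" for n
  proof (induction n)
    case (Suc n)
    then obtain r :: 'a where r: "r \<noteq> 0"
      "\<And>g. x_coeff (- 1 - int n) ((x_deriv ^^ n) g) = fps_const r * x_coeff (-1) g" by blast
    have "x_coeff (- 1 - int (Suc n)) ((x_deriv ^^ Suc n) g) = fps_const (- of_nat (Suc n) * r) * x_coeff (-1) g" for g
    proof -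
      have "x_coeff (- 1 - int (Suc n)) ((x_deriv ^^ Suc n) g) =
         fps_const (of_int (- 1 - int n)) * x_coeff (- 1 - int n) ((x_deriv ^^ n) g)"
        by (simp add: x_coeff_x_deriv algebra_simps)
      also have "\<dots> = fps_const (- of_nat (Suc n) * r) * x_coeff (-1) g"
        unfolding r(2) by (simp add: mult.assoc[symmetric])
      finally show ?thesis .
    qed
    moreover have "- of_nat (Suc n) * r \<noteq> 0"
      using r(1) by (simp del: of_nat_Suc)
    ultimately show ?case by blast
  qed (auto intro!: exI[of _ 1])
  with F have "x_coeff (-1) F = 0" by (metis fps_const_eq_0_iff mult_eq_0_iff x_coeff_0)
  moreover have "x_coeff (-1) F = (\<Sum>i\<le>B. fps_of_poly (c (i, j0)) * (fps_deriv ^^ i) (x_coeff (-1) f))"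
  proof -
    have "x_coeff (-1) F =
        (\<Sum>(i, j)\<in>{..B} \<times> {j0..B}. fps_of_poly (c (i, j)) * x_coeff (-1) (op (i, j - j0)))"
      unfolding F_def x_coeff_sum by (intro sum.cong) (auto simp: x_coeff_embed_mult)
    also have "\<dots> = (\<Sum>(i, j)\<in>{..B} \<times> {j0}. fps_of_poly (c (i, j)) * x_coeff (-1) (op (i, j - j0)))"
    proof (rule sum.mono_neutral_right)
      show "\<forall>ij\<in>{..B} \<times> {j0..B} - {..B} \<times> {j0}.
          (case ij of (i, j) \<Rightarrow> fps_of_poly (c (i, j)) * x_coeff (-1) (op (i, j - j0))) = 0"
      proof
        fix ij assume ij: "ij \<in> {..B} \<times> {j0..B} - {..B} \<times> {j0}"
        obtain i j where [simp]: "ij = (i, j)" by (cases ij)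
        from ij have "j0 < j" by auto
        then obtain m where "j - j0 = Suc m" by (cases "j - j0") auto
        thus "(case ij of (i, j) \<Rightarrow> fps_of_poly (c (i, j)) * x_coeff (-1) (op (i, j - j0))) = 0"
          by (simp add: op_def x_coeff_x_deriv)
      qed
    qed (use i0 in auto)
    also have "\<dots> = (\<Sum>i\<le>B. fps_of_poly (c (i, j0)) * x_coeff (-1) (op (i, 0)))"
      by (simp flip: sum.cartesian_product)
    finally show ?thesis
      by (simp add: op_def x_coeff_fps_deriv_iter)
  qed
  ultimately show ?thesis
    unfolding D_finite_def using i0 by (intro exI[of _ B] exI[of _ "\<lambda>i. c (i, j0)"]) auto
qed

section \<open>Sums of hyperexponential series\<close>

text \<open>Both logarithmic derivatives are rational, as for square roots of polynomials. Clearing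
  denominators avoids quotients in K((x))[[t]] and admits h = 0.\<close>

definition hyperexponential :: "'a::idom fls fps \<Rightarrow> bool" where
  "hyperexponential h \<longleftrightarrow> (\<exists>D M N. is_poly D \<and> is_poly M \<and> is_poly N \<and> D \<noteq> 0 \<and>
     D * fps_deriv h = M * h \<and> D * x_deriv h = N * h)"

text \<open>This class stands in for the algebraic series of the argument. Each summand is only
  multiplied by a rational function when differentiated, so all derivatives of f stay in the
  K(x,t)-space spanned by \<open>hs\<close>.\<close>

definition hyperexp_span :: "'a::idom fls fps \<Rightarrow> bool" where
  "hyperexp_span f \<longleftrightarrow> (\<exists>D hs. is_poly D \<and> D \<noteq> 0 \<and> (\<forall>h\<in>set hs. hyperexponential h) \<and>
     D * f = sum_list hs)"

lemma hyperexponential_poly: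
  assumes "is_poly P"
  shows "hyperexponential P"
proof (cases "P = 0")
  case True
  thus ?thesis
    unfolding hyperexponential_def by (intro exI[of _ 1] exI[of _ 0]) (auto intro: poly_intros)
next
  case False
  with assms show ?thesis unfolding hyperexponential_def
    by (intro exI[of _ P] exI[of _ "fps_deriv P"] exI[of _ "x_deriv P"])
       (auto intro: poly_intros simp: mult.commute)
qed

lemma hyperexponential_mult:
  assumes "hyperexponential g" "hyperexponential h"
  shows "hyperexponential (g * h)"
proof -
  from assms obtain D M N D' M' N' where
    D: "is_poly D" "is_poly M" "is_poly N" "D \<noteq> 0"
       "D * fps_deriv g = M * g" "D * x_deriv g = N * g" and
    D': "is_poly D'" "is_poly M'" "is_poly N'" "D' \<noteq> 0"
       "D' * fps_deriv h = M' * h" "D' * x_deriv h = N' * h"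
    unfolding hyperexponential_def by blast
  have "D * D' * fps_deriv (g * h) = D' * h * (D * fps_deriv g) + D * g * (D' * fps_deriv h)"
    by (simp add: algebra_simps)
  also have "\<dots> = (D' * M + D * M') * (g * h)"
    by (simp only: D D') (simp add: algebra_simps)
  finally have 1: "D * D' * fps_deriv (g * h) = (D' * M + D * M') * (g * h)" .
  have "D * D' * x_deriv (g * h) = D' * h * (D * x_deriv g) + D * g * (D' * x_deriv h)"
    by (simp add: x_deriv_mult algebra_simps)
  also have "\<dots> = (D' * N + D * N') * (g * h)"
    by (simp only: D D') (simp add: algebra_simps)
  finally have 2: "D * D' * x_deriv (g * h) = (D' * N + D * N') * (g * h)" .
  have "is_poly (D * D')" "is_poly (D' * M + D * M')" "is_poly (D' * N + D * N')" "D * D' \<noteq> 0"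
    using D D' by (auto intro: poly_intros)
  with 1 2 show ?thesis unfolding hyperexponential_def by blast
qed

lemma hyperexponential_sqrt:
  fixes s :: "'a::field_char_0 fls fps"
  assumes "is_poly (s ^ 2)"
  shows "hyperexponential s"
proof (cases "s = 0")
  case False
  have "2 * s ^ 2 * fps_deriv s = fps_deriv (s ^ 2) * s"
    "2 * s ^ 2 * x_deriv s = x_deriv (s ^ 2) * s"
    by (simp_all add: power2_eq_square x_deriv_mult algebra_simps)
  moreover have "is_poly (2 * s ^ 2)" "is_poly (fps_deriv (s ^ 2))" "is_poly (x_deriv (s ^ 2))"
    using assms by (blast intro: poly_intros)+
  moreover have "2 * s ^ 2 \<noteq> 0" using False by simp
  ultimately show ?thesis unfolding hyperexponential_def by blast
qed (auto intro: hyperexponential_poly poly_intros)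

lemma hyperexponential_common_denominator:
  fixes hs :: "'a::idom fls fps list"
  assumes "\<forall>h\<in>set hs. hyperexponential h"
  shows "\<exists>D. is_poly D \<and> D \<noteq> 0 \<and> (\<forall>h\<in>set hs. \<exists>M N. is_poly M \<and> is_poly N \<and>
           D * fps_deriv h = M * h \<and> D * x_deriv h = N * h)"
  using assms
proof (induction hs)
  case Nil
  show ?case by (intro exI[of _ 1]) (auto intro: poly_intros)
next
  case (Cons g hs)
  then obtain D where D: "is_poly D" "D \<noteq> 0"
    "\<And>h. h \<in> set hs \<Longrightarrow> \<exists>M N. is_poly M \<and> is_poly N \<and>
        D * fps_deriv h = M * h \<and> D * x_deriv h = N * h"
    by auto
  from Cons obtain E M N where E: "is_poly E" "E \<noteq> 0" "is_poly M" "is_poly N"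
    "E * fps_deriv g = M * g" "E * x_deriv g = N * g"
    unfolding hyperexponential_def by auto
  have "\<exists>M N. is_poly M \<and> is_poly N \<and>
      E * D * fps_deriv h = M * h \<and> E * D * x_deriv h = N * h" if h: "h \<in> set (g # hs)" for h
  proof (cases "h = g")
    case True
    with E D show ?thesis
      by (intro exI[of _ "D * M"] exI[of _ "D * N"]) (auto intro: poly_intros simp: mult_ac)
  next
    case False
    with h have "h \<in> set hs" by simp
    from D(3)[OF this] obtain M N where "is_poly M" "is_poly N"
      "D * fps_deriv h = M * h" "D * x_deriv h = N * h" by blast
    with E show ?thesis
      by (intro exI[of _ "E * M"] exI[of _ "E * N"]) (auto intro: poly_intros simp: mult_ac)
  qed
  with D(1,2) E(1,2) show ?case
    by (intro exI[of _ "E * D"]) (auto intro: poly_intros)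
qed

lemma hyperexp_span_residue_D_finite:
  fixes f :: "'a::field_char_0 fls fps"
  assumes "hyperexp_span f"
  shows "D_finite (x_coeff (-1) f)"
proof -
  from assms obtain D hs where D: "is_poly D" "D \<noteq> 0" and hs: "\<forall>h\<in>set hs. hyperexponential h"
    and f: "D * f = sum_list hs"
    unfolding hyperexp_span_def by blast
  obtain E where E: "is_poly E" "E \<noteq> 0"
    and ex: "\<forall>h\<in>set hs. \<exists>M N. is_poly M \<and> is_poly N \<and>
           E * fps_deriv h = M * h \<and> E * x_deriv h = N * h"
    using hyperexponential_common_denominator[OF hs] by blast
  let ?s = "length hs"
  \<comment> \<open>\<open>residue_D_finite\<close> uses one and the same polynomial as denominator
    of f and in all differential equations. Scaling the summands by E makes D * E fit both
    purposes.\<close>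
  define h where "h = (\<lambda>k. E * hs ! k)"
  have "\<exists>M N. D * E * fps_deriv (h k) = poly_embed M * h k \<and>
              D * E * x_deriv (h k) = poly_embed N * h k" if "k < ?s" for k
  proof -
    have "hs ! k \<in> set hs" using that by simp
    with ex obtain M N where MN: "is_poly M" "is_poly N"
      "E * fps_deriv (hs ! k) = M * hs ! k" "E * x_deriv (hs ! k) = N * hs ! k"
      by blast
    have "D * E * fps_deriv (h k) = D * fps_deriv E * h k + D * E * (E * fps_deriv (hs ! k))"
      by (simp add: h_def algebra_simps)
    also have "\<dots> = (D * fps_deriv E + D * M) * h k"
      unfolding MN by (simp add: h_def algebra_simps)
    finally have 1: "D * E * fps_deriv (h k) = (D * fps_deriv E + D * M) * h k" .
    have "D * E * x_deriv (h k) = D * x_deriv E * h k + D * E * (E * x_deriv (hs ! k))"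
      by (simp add: h_def x_deriv_mult algebra_simps)
    also have "\<dots> = (D * x_deriv E + D * N) * h k"
      unfolding MN by (simp add: h_def algebra_simps)
    finally have 2: "D * E * x_deriv (h k) = (D * x_deriv E + D * N) * h k" .
    have "is_poly (D * fps_deriv E + D * M)" "is_poly (D * x_deriv E + D * N)"
      using D E MN by (auto intro!: poly_intros)
    with 1 2 show ?thesis unfolding is_poly_def by metis
  qed
  then obtain M N where MN: "\<And>k. k < ?s \<Longrightarrow> D * E * fps_deriv (h k) = poly_embed (M k) * h k"
    "\<And>k. k < ?s \<Longrightarrow> D * E * x_deriv (h k) = poly_embed (N k) * h k" by metis
  from D E have "is_poly (D * E)" by (intro poly_intros)
  then obtain P where P: "D * E = poly_embed P" by (auto simp: is_poly_def)
  have "D * E * f = (\<Sum>k<?s. h k)"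
    using f by (simp add: h_def sum_list_sum_nth mult_ac atLeast0LessThan flip: sum_distrib_left)
  thus ?thesis
    using residue_D_finite[of P ?s h M N f] MN D(2) E(2) unfolding P by (metis P mult_eq_0_iff)
qed

section \<open>Closure properties of \<open>hyperexp_span\<close>: ring operations, division by
  polynomials, quadratic roots\<close>

named_theorems span_intros

lemma hyperexp_span_hyperexponential:
  assumes "hyperexponential h"
  shows "hyperexp_span h"
  unfolding hyperexp_span_def using assms
  by (intro exI[of _ 1] exI[of _ "[h]"]) (auto intro: poly_intros)

lemma hyperexp_span_poly: "is_poly P \<Longrightarrow> hyperexp_span P"
  by (intro hyperexp_span_hyperexponential hyperexponential_poly)

lemma hyperexp_span_mult [span_intros]:
  assumes "hyperexp_span f" "hyperexp_span g"
  shows "hyperexp_span (f * g)"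
proof -
  from assms obtain D hs E hs' where D: "is_poly D" "D \<noteq> 0" "\<forall>h\<in>set hs. hyperexponential h"
    "D * f = sum_list hs" and E: "is_poly E" "E \<noteq> 0" "\<forall>h\<in>set hs'. hyperexponential h"
    "E * g = sum_list hs'" unfolding hyperexp_span_def by blast
  have "sum_list hs * sum_list hs' = sum_list (concat (map (\<lambda>h. map ((*) h) hs') hs))"
    by (induction hs) (auto simp: sum_list_const_mult algebra_simps)
  hence "D * E * (f * g) = sum_list (concat (map (\<lambda>h. map ((*) h) hs') hs))"
    using D(4) E(4) by (metis (no_types, lifting) mult.assoc mult.left_commute)
  moreover have "\<forall>h\<in>set (concat (map (\<lambda>h. map ((*) h) hs') hs)). hyperexponential h"
    using D(3) E(3) by (auto intro: hyperexponential_mult)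
  moreover have "is_poly (D * E)" "D * E \<noteq> 0" using D E by (auto intro: poly_intros)
  ultimately show ?thesis unfolding hyperexp_span_def by blast
qed

lemma hyperexp_span_cancel:
  assumes "is_poly D" "D \<noteq> 0" "hyperexp_span (D * f)"
  shows "hyperexp_span f"
proof -
  from assms(3) obtain E hs where E: "is_poly E" "E \<noteq> 0" "\<forall>h\<in>set hs. hyperexponential h"
    "E * (D * f) = sum_list hs" unfolding hyperexp_span_def by blast
  with assms show ?thesis unfolding hyperexp_span_def
    by (intro exI[of _ "E * D"] exI[of _ hs]) (auto intro: poly_intros simp: mult.assoc)
qed

lemma hyperexp_span_add [span_intros]:
  assumes "hyperexp_span f" "hyperexp_span g"
  shows "hyperexp_span (f + g)"
proof -
  from assms obtain D hs E hs' where D: "is_poly D" "D \<noteq> 0" "\<forall>h\<in>set hs. hyperexponential h"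
    "D * f = sum_list hs" and E: "is_poly E" "E \<noteq> 0" "\<forall>h\<in>set hs'. hyperexponential h"
    "E * g = sum_list hs'" unfolding hyperexp_span_def by blast
  have "D * E * (f + g) = E * (D * f) + D * (E * g)"
    by (simp add: algebra_simps)
  also have "\<dots> = sum_list (map ((*) E) hs @ map ((*) D) hs')"
    unfolding D E by (simp add: sum_list_const_mult[of _ "\<lambda>x. x", simplified])
  finally have "D * E * (f + g) = sum_list (map ((*) E) hs @ map ((*) D) hs')" .
  moreover have "\<forall>h\<in>set (map ((*) E) hs @ map ((*) D) hs'). hyperexponential h"
    using D E by (auto intro!: hyperexponential_mult intro: hyperexponential_poly)
  moreover have "is_poly (D * E)" "D * E \<noteq> 0" using D E by (auto intro: poly_intros)
  ultimately show ?thesis unfolding hyperexp_span_def by blast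
qed

lemma hyperexp_span_uminus [span_intros]:
  assumes "hyperexp_span f"
  shows "hyperexp_span (- f)"
proof -
  have "hyperexp_span ((- 1) * f)"
    by (intro hyperexp_span_mult hyperexp_span_poly poly_intros assms)
  thus ?thesis by simp
qed

lemma hyperexp_span_diff [span_intros]:
  "hyperexp_span f \<Longrightarrow> hyperexp_span g \<Longrightarrow> hyperexp_span (f - g)"
  using hyperexp_span_add[OF _ hyperexp_span_uminus, of f g] by simp

lemma hyperexp_span_power [span_intros]: "hyperexp_span f \<Longrightarrow> hyperexp_span (f ^ n)"
  by (induction n) (auto intro: span_intros hyperexp_span_poly poly_intros)

lemmas hyperexp_span_basic [span_intros] =
  hyperexp_span_poly[OF is_poly_0] hyperexp_span_poly[OF is_poly_1]
  hyperexp_span_poly[OF is_poly_numeral] hyperexp_span_poly[OF is_poly_const]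
  hyperexp_span_poly[OF is_poly_xvar] hyperexp_span_poly[OF is_poly_fps_X]

lemma hyperexp_span_xinv [span_intros]: "hyperexp_span xinv"
  by (rule hyperexp_span_cancel[of xvar]) (auto intro: span_intros poly_intros)

text \<open>Completing the square: 2 U Y + V is a square root of the discriminant, hence
  hyperexponential.\<close>

lemma hyperexp_span_quadratic:
  fixes Y :: "'a::field_char_0 fls fps"
  assumes "is_poly U" "is_poly V" "is_poly W" "U \<noteq> 0" "U * Y ^ 2 + V * Y + W = 0"
  shows "hyperexp_span Y"
proof -
  have "(2 * U * Y + V) ^ 2 = 4 * U * (U * Y ^ 2 + V * Y + W) + (V ^ 2 - 4 * U * W)"
    by (simp add: algebra_simps power2_eq_square)
  hence "(2 * U * Y + V) ^ 2 = V ^ 2 - 4 * U * W"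
    using assms by simp
  moreover have "is_poly (V ^ 2 - 4 * U * W)"
    by (intro poly_intros assms)
  ultimately have "hyperexponential (2 * U * Y + V)"
    by (metis hyperexponential_sqrt)
  hence "hyperexp_span (2 * U * Y + V)"
    by (rule hyperexp_span_hyperexponential)
  hence "hyperexp_span (2 * U * Y + V - V)"
    using hyperexp_span_diff hyperexp_span_poly assms(2) by blast
  hence "hyperexp_span ((2 * U) * Y)" by simp
  moreover have "is_poly (2 * U)" "2 * U \<noteq> 0" using assms by (auto intro: poly_intros)
  ultimately show ?thesis by (metis hyperexp_span_cancel)
qed

text \<open>Rationalising the denominator: in every use f' is, up to a polynomial factor, the
  conjugate of f, P is the resulting norm, and 1/f = f'/P.\<close>

lemma hyperexp_span_inverse:
  assumes "f * g = 1" "f * f' = P" "is_poly P" "P \<noteq> 0" "hyperexp_span f'"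
  shows "hyperexp_span g"
proof (rule hyperexp_span_cancel)
  have "P * g = (f * g) * f'" using assms by (simp add: mult_ac flip: assms(2))
  thus "hyperexp_span (P * g)" using assms by simp
qed (use assms in auto)

text \<open>Multiplication by x^(-n-1), which stays inside the span, moves the wanted coefficient to
  the residue.\<close>

lemma hyperexp_span_coeff_D_finite:
  fixes f :: "'a::field_char_0 fls fps"
  assumes "hyperexp_span f"
  shows "D_finite (x_coeff (int n) f)"
proof -
  have "x_coeff (-1) (xinv ^ Suc n * f) = x_coeff (int n) f"
  proof (induction n arbitrary: f)
    case (Suc n)
    have "x_coeff (-1) (xinv ^ Suc (Suc n) * f) = x_coeff (-1) (xinv ^ Suc n * (xinv * f))"
      by (simp add: mult_ac)
    thus ?case by (simp only: Suc x_coeff_xinv_mult) (simp add: add.commute)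
  qed (simp add: x_coeff_xinv_mult)
  moreover have "hyperexp_span (xinv ^ Suc n * f)"
    by (intro span_intros assms)
  ultimately show ?thesis using hyperexp_span_residue_D_finite by metis
qed

section \<open>Quadratic equations and one-sided series\<close>

definition agree_upto :: "nat \<Rightarrow> 'r::comm_ring_1 fps \<Rightarrow> 'r fps \<Rightarrow> bool" where
  "agree_upto n f g \<longleftrightarrow> (\<forall>k<n. f $ k = g $ k)"

lemma agree_upto_mult:
  assumes "agree_upto n f f'" "agree_upto n g g'"
  shows "agree_upto n (f * g) (f' * g')"
  using assms unfolding agree_upto_def fps_mult_nth by (auto intro!: sum.cong)

text \<open>The leading factor t makes the right-hand side a contraction: each application settles
  one more coefficient. The ring is arbitrary because the kernel roots Y live over K((x)) while the
  root z of the Wiener-Hopf factor lives over K.\<close>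

lemma quadratic_fixed_point_exists:
  fixes A B C :: "'r::comm_ring_1 fps"
  shows "\<exists>Y. Y = fps_X * (A + B * Y + C * Y ^ 2)"
proof -
  define F where "F = (\<lambda>Y. fps_X * (A + B * Y + C * Y ^ 2))"
  have F: "agree_upto (Suc n) (F f) (F g)" if "agree_upto n f g" for n f g
  proof -
    have "agree_upto n h h" for h :: "'r fps" by (simp add: agree_upto_def)
    hence "agree_upto n (A + B * f + C * f ^ 2) (A + B * g + C * g ^ 2)"
      using agree_upto_mult[of n B B f g] agree_upto_mult[of n C C "f ^ 2" "g ^ 2"]
        agree_upto_mult[of n f g f g] that
      by (auto simp: agree_upto_def power2_eq_square)
    thus ?thesis
      unfolding F_def agree_upto_def by (auto simp: fps_X_mult_nth)
  qed
  define y where "y = (\<lambda>n. (F ^^ n) 0)"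
  have agree: "agree_upto n (y n) (y (n + m))" for n m
    by (induction n) (auto simp: y_def agree_upto_def[of 0] intro: F)
  define Y where "Y = Abs_fps (\<lambda>k. y (Suc k) $ k)"
  have Y: "agree_upto n Y (y n)" for n
    unfolding agree_upto_def
  proof safe
    fix k assume "k < n"
    with agree[of "Suc k" "n - Suc k"] show "Y $ k = y n $ k"
      by (simp add: Y_def agree_upto_def)
  qed
  have "Y = F Y"
  proof (rule fps_ext)
    fix n
    have "agree_upto (Suc n) (F Y) (y (Suc n))"
      using F[OF Y[of n]] by (simp add: y_def)
    with Y[of "Suc n"] show "Y $ n = F Y $ n"
      by (simp add: agree_upto_def)
  qed
  thus ?thesis unfolding F_def by blast
qed

section \<open>Series without positive powers of x\<close>

definition x_nonpos :: "'a::comm_ring_1 fls fps \<Rightarrow> bool" where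
  "x_nonpos f \<longleftrightarrow> (\<forall>k>0. x_coeff k f = 0)"

lemma fls_nth_mult_nonpos:
  fixes f g :: "'a::comm_ring_1 fls"
  assumes "\<forall>i>0. f $$ i = 0 \<and> g $$ i = 0" "k \<ge> 0"
  shows "(f * g) $$ k = (if k = 0 then f $$ 0 * g $$ 0 else 0)"
proof -
  have "f $$ i * g $$ (k - i) = (if i = 0 then if k = 0 then f $$ 0 * g $$ 0 else 0 else 0)" for i
  proof (cases "i = 0")
    case False
    with assms have "f $$ i = 0 \<or> g $$ (k - i) = 0" by (cases "i > 0") auto
    with False show ?thesis by auto
  qed (use assms in auto)
  hence "(f * g) $$ k = (\<Sum>i=fls_subdegree f..k - fls_subdegree g.
      if i = 0 then if k = 0 then f $$ 0 * g $$ 0 else 0 else 0)"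
    unfolding fls_times_nth(2) by simp
  also have "\<dots> = (if k = 0 then f $$ 0 * g $$ 0 else 0)"
    by (auto simp: sum.delta)
  finally show ?thesis .
qed

text \<open>Exponents that are at most 0 add up to 0 only if both are 0, so the constant term is
  multiplicative on such series. In Model 17 this reduces the whole term with Q(0,1/x) to a multiple
  of G.\<close>

lemma
  assumes "x_nonpos f" "x_nonpos g"
  shows x_nonpos_mult: "x_nonpos (f * g)"
    and x_coeff_0_mult_nonpos: "x_coeff 0 (f * g) = x_coeff 0 f * x_coeff 0 g"
proof -
  have "x_coeff k (f * g) = (if k = 0 then x_coeff 0 f * x_coeff 0 g else 0)" if "k \<ge> 0" for k
    using assms that by (intro fps_ext)
      (auto simp: x_nonpos_def fps_eq_iff fps_mult_nth fls_nth_sum fls_nth_mult_nonpos)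
  thus "x_nonpos (f * g)" "x_coeff 0 (f * g) = x_coeff 0 f * x_coeff 0 g"
    by (auto simp: x_nonpos_def)
qed

text \<open>The series u is the sum of z^n x^(-n), which converges t-adically because z has no
  constant term.\<close>

lemma x_nonpos_geometric:
  fixes z :: "'a::field fps"
  assumes "z $ 0 = 0"
  obtains u where "(1 - fps_embed z * xinv) * u = 1" "x_nonpos u" "x_coeff 0 u = 1"
proof -
  let ?w = "1 - fps_embed z * xinv :: 'a fls fps"
  define u where "u = inverse ?w"
  have "?w $ 0 \<noteq> 0" using assms by simp
  hence u: "?w * u = 1" unfolding u_def by (rule inverse_mult_eq_1')
  hence rec: "u = 1 + xinv * (fps_embed z * u)" by (simp add: algebra_simps)
  have "u $ n $$ k = (if n = 0 \<and> k = 0 then 1 else 0)" if "k \<ge> 0" for n k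
    using that
  proof (induction n arbitrary: k rule: less_induct)
    case (less n)
    have "(z * x_coeff (k + 1) u) $ n = (\<Sum>i\<le>n. z $ i * u $ (n - i) $$ (k + 1))"
      by (simp add: fps_mult_nth atMost_atLeast0)
    also have "\<dots> = 0"
    proof (intro sum.neutral ballI)
      fix i assume "i \<in> {..n}"
      show "z $ i * u $ (n - i) $$ (k + 1) = 0"
        using assms less.IH[of "n - i" "k + 1"] less.prems \<open>i \<in> {..n}\<close> by (cases "i = 0") auto
    qed
    finally have "x_coeff k (xinv * (fps_embed z * u)) $ n = 0"
      unfolding x_coeff_xinv_mult x_coeff_embed_mult .
    moreover have "u $ n $$ k = (1 :: 'a fls fps) $ n $$ k + x_coeff k (xinv * (fps_embed z * u)) $ n"
      by (subst rec) (simp only: fps_add_nth fls_plus_nth x_coeff_nth)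
    ultimately show ?case by simp
  qed
  hence "x_nonpos u" "x_coeff 0 u = 1"
    by (auto simp: x_nonpos_def intro!: fps_ext)
  with u show ?thesis using that by blast
qed

section \<open>Walks in the quarter plane\<close>

definition walk_weight :: "'a::comm_ring_1 \<Rightarrow> 'a \<Rightarrow> step list \<Rightarrow> 'a" where
  "walk_weight a b w = a ^ horizontal_visits w * b ^ vertical_visits w"

definition walk_end :: "step list \<Rightarrow> nat \<times> nat" where
  "walk_end w = (nat (fst (vertex w (length w))), nat (snd (vertex w (length w))))"

definition allowed_steps :: "step set \<Rightarrow> nat \<times> nat \<Rightarrow> step set" where
  "allowed_steps S p = {s \<in> S. int (fst p) + fst s \<ge> 0 \<and> int (snd p) + snd s \<ge> 0}"

text \<open>The truncation by \<open>nat\<close> never acts on a step in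
  \<open>allowed_steps\<close>. Natural coordinates serve directly as exponents of
  monomials.\<close>

definition walk_step :: "nat \<times> nat \<Rightarrow> step \<Rightarrow> nat \<times> nat" where
  "walk_step p s = (nat (int (fst p) + fst s), nat (int (snd p) + snd s))"

lemma vertex_append: "i \<le> length w \<Longrightarrow> vertex (w @ [s]) i = vertex w i"
  by (simp add: vertex_def)

lemma vertex_append_last: "vertex (w @ [s]) (Suc (length w)) = vertex w (length w) + s"
  by (simp add: vertex_def)

lemma finite_quarter_plane_walks: "finite S \<Longrightarrow> finite (quarter_plane_walks S n)"
  by (rule finite_subset[OF _ finite_lists_length_eq[of S n]])
     (auto simp: quarter_plane_walks_def)

lemma quarter_plane_walks_0: "quarter_plane_walks S 0 = {[]}"
  by (auto simp: quarter_plane_walks_def vertex_def)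

lemma vertex_eq_walk_end:
  assumes "w \<in> quarter_plane_walks S n"
  shows "vertex w n = (int (fst (walk_end w)), int (snd (walk_end w)))"
  using assms by (auto simp: quarter_plane_walks_def walk_end_def prod_eq_iff)

lemma quarter_plane_walks_Suc:
  "quarter_plane_walks S (Suc n) =
     (\<lambda>(w, s). w @ [s]) ` (SIGMA w:quarter_plane_walks S n. allowed_steps S (walk_end w))"
proof (intro equalityI subsetI)
  fix v assume v: "v \<in> quarter_plane_walks S (Suc n)"
  then obtain w s where ws: "v = w @ [s]" "length w = n"
    by (auto simp: quarter_plane_walks_def length_Suc_conv_rev)
  have ge: "0 \<le> fst (vertex w i) \<and> 0 \<le> snd (vertex w i)" if "i \<le> n" for i
  proof -
    have "\<forall>i\<le>Suc n. 0 \<le> fst (vertex v i) \<and> 0 \<le> snd (vertex v i)"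
      using v by (auto simp: quarter_plane_walks_def)
    with that have "0 \<le> fst (vertex v i) \<and> 0 \<le> snd (vertex v i)" by simp
    thus ?thesis using that ws vertex_append[of i w s] by simp
  qed
  hence w: "w \<in> quarter_plane_walks S n"
    using v ws by (auto simp: quarter_plane_walks_def)
  moreover have "0 \<le> fst (vertex w n + s) \<and> 0 \<le> snd (vertex w n + s)"
    using v ws vertex_append_last[of w s] by (auto simp: quarter_plane_walks_def)
  hence "s \<in> allowed_steps S (walk_end w)"
    using v ws vertex_eq_walk_end[OF w] by (auto simp: quarter_plane_walks_def allowed_steps_def)
  ultimately show "v \<in> (\<lambda>(w, s). w @ [s]) `
      (SIGMA w:quarter_plane_walks S n. allowed_steps S (walk_end w))"
    using ws by force
next
  fix v assume "v \<in> (\<lambda>(w, s). w @ [s]) `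
      (SIGMA w:quarter_plane_walks S n. allowed_steps S (walk_end w))"
  then obtain w s where ws: "v = w @ [s]" "w \<in> quarter_plane_walks S n"
    "s \<in> allowed_steps S (walk_end w)" by auto
  hence len: "length w = n" by (simp add: quarter_plane_walks_def)
  have "0 \<le> fst (vertex (w @ [s]) i) \<and> 0 \<le> snd (vertex (w @ [s]) i)" if "i \<le> Suc n" for i
  proof (cases "i = Suc n")
    case True
    with ws len vertex_append_last[of w s] vertex_eq_walk_end[OF ws(2)] show ?thesis
      by (simp add: allowed_steps_def)
  next
    case False
    with that ws len vertex_append[of i w s] show ?thesis
      by (simp add: quarter_plane_walks_def)
  qed
  thus "v \<in> quarter_plane_walks S (Suc n)"
    using ws len by (auto simp: quarter_plane_walks_def allowed_steps_def)
qed

lemma sum_quarter_plane_walks_Suc: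
  assumes "finite S"
  shows "(\<Sum>v\<in>quarter_plane_walks S (Suc n). F v) =
    (\<Sum>w\<in>quarter_plane_walks S n. \<Sum>s\<in>allowed_steps S (walk_end w). F (w @ [s]))"
proof -
  have "inj_on (\<lambda>(w, s). w @ [s]) A" for A :: "(step list \<times> step) set"
    by (auto simp: inj_on_def)
  moreover have "finite (allowed_steps S p)" for p
    using assms by (simp add: allowed_steps_def)
  ultimately show ?thesis
    using assms unfolding quarter_plane_walks_Suc
    by (subst sum.reindex) (auto simp: sum.Sigma finite_quarter_plane_walks case_prod_beta)
qed

lemma card_visits_Suc:
  "card {i \<in> {1..Suc n}. P i} = card {i \<in> {1..n}. P i} + (if P (Suc n) then 1 else 0)"
proof -
  have "{i \<in> {1..Suc n}. P i} = {i \<in> {1..n}. P i} \<union> (if P (Suc n) then {Suc n} else {})"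
    by (auto simp: le_Suc_eq)
  thus ?thesis by simp
qed

lemma
  assumes w: "w \<in> quarter_plane_walks S n" and s: "s \<in> allowed_steps S (walk_end w)"
  shows walk_end_append: "walk_end (w @ [s]) = walk_step (walk_end w) s"
    and walk_weight_append: "walk_weight a b (w @ [s]) = walk_weight a b w *
      ((if snd (walk_step (walk_end w) s) = 0 then a else 1) *
       (if fst (walk_step (walk_end w) s) = 0 then b else 1))"
proof -
  have n: "length w = n" using w by (simp add: quarter_plane_walks_def)
  have v: "vertex (w @ [s]) (Suc n) = vertex w n + s"
    using vertex_append_last[of w s] n by simp
  show "walk_end (w @ [s]) = walk_step (walk_end w) s"
    using v n vertex_eq_walk_end[OF w] by (simp add: walk_end_def[of "w @ [s]"] walk_step_def)
  have zero: "fst (vertex (w @ [s]) (Suc n)) = 0 \<longleftrightarrow> fst (walk_step (walk_end w) s) = 0"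
    "snd (vertex (w @ [s]) (Suc n)) = 0 \<longleftrightarrow> snd (walk_step (walk_end w) s) = 0"
    using v s vertex_eq_walk_end[OF w] by (auto simp: walk_step_def allowed_steps_def)
  have "{i \<in> {1..n}. snd (vertex (w @ [s]) i) = 0} = {i \<in> {1..n}. snd (vertex w i) = 0}"
    "{i \<in> {1..n}. fst (vertex (w @ [s]) i) = 0} = {i \<in> {1..n}. fst (vertex w i) = 0}"
    using n vertex_append[of _ w s] by auto
  hence "horizontal_visits (w @ [s]) =
      horizontal_visits w + (if snd (walk_step (walk_end w) s) = 0 then 1 else 0)"
    "vertical_visits (w @ [s]) =
      vertical_visits w + (if fst (walk_step (walk_end w) s) = 0 then 1 else 0)"
    using n zero unfolding horizontal_visits_def vertical_visits_def
    by (simp_all only: length_append_singleton card_visits_Suc)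
  thus "walk_weight a b (w @ [s]) = walk_weight a b w *
      ((if snd (walk_step (walk_end w) s) = 0 then a else 1) *
       (if fst (walk_step (walk_end w) s) = 0 then b else 1))"
    by (simp add: walk_weight_def power_add)
qed

definition endpoint_gf :: "step set \<Rightarrow> 'a::comm_ring_1 \<Rightarrow> 'a \<Rightarrow> nat \<times> nat \<Rightarrow> 'a fps" where
  "endpoint_gf S a b p =
     Abs_fps (\<lambda>n. \<Sum>w\<in>quarter_plane_walks S n. if walk_end w = p then walk_weight a b w else 0)"

lemma excursion_gf_eq_endpoint_gf:
  assumes "finite S"
  shows "excursion_gf S a b = endpoint_gf S a b (0, 0)"
proof (rule fps_ext)
  fix n
  let ?W = "\<lambda>h v. {w \<in> quarter_plane_walks S n. vertex w n = (int 0, int 0) \<and>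
              horizontal_visits w = h \<and> vertical_visits w = v}"
  have fin: "finite (quarter_plane_walks S n)" by (rule finite_quarter_plane_walks) fact
  have le: "horizontal_visits w \<le> n" "vertical_visits w \<le> n" if "w \<in> quarter_plane_walks S n" for w
  proof -
    have "card {i \<in> {1..length w}. P i} \<le> card {1..length w}" for P
      by (rule card_mono) auto
    hence "card {i \<in> {1..length w}. P i} \<le> n" for P
      using that by (simp add: quarter_plane_walks_def)
    thus "horizontal_visits w \<le> n" "vertical_visits w \<le> n"
      by (auto simp: horizontal_visits_def vertical_visits_def)
  qed
  have "excursion_gf S a b $ n =
      (\<Sum>h\<le>n. \<Sum>v\<le>n. \<Sum>w\<in>quarter_plane_walks S n.
         if w \<in> ?W h v then walk_weight a b w else 0)"
    unfolding excursion_gf_def num_walks_def fps_nth_Abs_fps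
  proof (intro sum.cong refl)
    fix h v
    have "of_nat (card (?W h v)) * a ^ h * b ^ v = (\<Sum>w\<in>?W h v. walk_weight a b w)"
      by (simp add: walk_weight_def mult.assoc)
    also have "\<dots> = (\<Sum>w\<in>quarter_plane_walks S n. if w \<in> ?W h v then walk_weight a b w else 0)"
      using fin by (subst sum.inter_restrict[symmetric]) (auto intro!: sum.cong)
    finally show "of_nat (card (?W h v)) * a ^ h * b ^ v = \<dots>" .
  qed
  also have "\<dots> = (\<Sum>w\<in>quarter_plane_walks S n. \<Sum>h\<le>n. \<Sum>v\<le>n.
         if w \<in> ?W h v then walk_weight a b w else 0)"
    by (subst sum.swap, subst (2) sum.swap, rule refl)
  also have "\<dots> = (\<Sum>w\<in>quarter_plane_walks S n.
      if walk_end w = (0, 0) then walk_weight a b w else 0)"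
  proof (intro sum.cong refl)
    fix w assume w: "w \<in> quarter_plane_walks S n"
    have "(if w \<in> ?W h v then walk_weight a b w else 0) =
        (if h = horizontal_visits w then if v = vertical_visits w then
           if walk_end w = (0, 0) then walk_weight a b w else 0 else 0 else 0)" for h v
      using w vertex_eq_walk_end[OF w] by (cases "walk_end w") auto
    moreover have "(\<Sum>v\<le>n. if h = horizontal_visits w then if v = vertical_visits w then c else 0 else 0)
        = (if h = horizontal_visits w then c else 0)" for h and c :: 'a
      using le[OF w] by simp
    ultimately show "(\<Sum>h\<le>n. \<Sum>v\<le>n. if w \<in> ?W h v then walk_weight a b w else 0) =
        (if walk_end w = (0, 0) then walk_weight a b w else 0)"
      using le[OF w] by simp
  qed
  finally show "excursion_gf S a b $ n = endpoint_gf S a b (0, 0) $ n"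
    by (simp add: endpoint_gf_def)
qed

section \<open>The kernel equation\<close>

text \<open>\<open>t_sum W\<close> is the \<open>t\<close>-adically convergent sum of the series \<open>t\<^sup>n W\<^sub>n\<close>.\<close>

definition t_sum :: "(nat \<Rightarrow> 'r::comm_ring_1 fps) \<Rightarrow> 'r fps" where
  "t_sum W = Abs_fps (\<lambda>m. \<Sum>n\<le>m. W n $ (m - n))"

lemma t_sum_nth: 
  assumes "m \<le> M"
  shows "t_sum W $ m = (\<Sum>n\<le>M. fps_X ^ n * W n) $ m"
proof -
  have "(\<Sum>n\<le>M. fps_X ^ n * W n) $ m = (\<Sum>n\<le>M. if m < n then 0 else W n $ (m - n))"
    by (simp add: fps_sum_nth fps_X_power_mult_nth)
  also have "\<dots> = (\<Sum>n\<le>m. W n $ (m - n))"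
    using assms by (intro sum.mono_neutral_cong_right) auto
  finally show ?thesis by (simp add: t_sum_def)
qed

lemma t_sum_rec: "t_sum W = W 0 + fps_X * t_sum (\<lambda>n. W (Suc n))"
proof (rule fps_ext)
  fix m
  show "t_sum W $ m = (W 0 + fps_X * t_sum (\<lambda>n. W (Suc n))) $ m"
    by (cases m) (auto simp: t_sum_def sum.atMost_Suc_shift simp del: sum.atMost_Suc)
qed

lemma t_sum_add: "t_sum (\<lambda>n. V n + W n) = t_sum V + t_sum W"
  and t_sum_diff: "t_sum (\<lambda>n. V n - W n) = t_sum V - t_sum W"
  by (auto intro!: fps_ext simp: t_sum_def sum.distrib sum_subtractf)

lemma t_sum_mult: "t_sum (\<lambda>n. c * W n) = c * t_sum W"
proof (rule fps_ext)
  fix m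
  have "(c * t_sum W) $ m = (\<Sum>i=0..m. c $ i * (\<Sum>n\<le>m. fps_X ^ n * W n) $ (m - i))"
    unfolding fps_mult_nth by (intro sum.cong refl) (simp add: t_sum_nth[of _ m])
  also have "\<dots> = (c * (\<Sum>n\<le>m. fps_X ^ n * W n)) $ m"
    by (simp add: fps_mult_nth)
  also have "c * (\<Sum>n\<le>m. fps_X ^ n * W n) = (\<Sum>n\<le>m. fps_X ^ n * (c * W n))"
    by (simp add: sum_distrib_left mult_ac)
  also have "\<dots> $ m = t_sum (\<lambda>n. c * W n) $ m"
    by (simp add: t_sum_nth[of m m])
  finally show "t_sum (\<lambda>n. c * W n) $ m = (c * t_sum W) $ m" ..
qed

lemma t_sum_const: "t_sum (\<lambda>n. fps_const (c n)) = Abs_fps c"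
proof (rule fps_ext)
  fix m
  have "(\<Sum>n\<le>m. fps_const (c n) $ (m - n)) = (\<Sum>n\<le>m. if n = m then c n else 0)"
    by (intro sum.cong) auto
  thus "t_sum (\<lambda>n. fps_const (c n)) $ m = Abs_fps c $ m"
    by (simp add: t_sum_def)
qed

abbreviation scalar :: "'a::comm_ring_1 \<Rightarrow> 'a fls fps" where
  "scalar c \<equiv> fps_const (fls_const c)"

definition weighted_sum ::
  "step set \<Rightarrow> 'a::comm_ring_1 \<Rightarrow> 'a \<Rightarrow> (nat \<times> nat \<Rightarrow> 'a fls fps) \<Rightarrow> 'a fls fps" where
  "weighted_sum S a b F =
     t_sum (\<lambda>n. \<Sum>w\<in>quarter_plane_walks S n. scalar (walk_weight a b w) * F (walk_end w))"

abbreviation walk_monomial :: "'r::comm_ring_1 \<Rightarrow> 'r \<Rightarrow> nat \<times> nat \<Rightarrow> 'r" where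
  "walk_monomial X Z p \<equiv> X ^ fst p * Z ^ snd p"

text \<open>Since t marks the length, the sum converges t-adically whatever X and Z are, so Q may be
  evaluated at Y or 1/x without conditions on their orders. By 0^0 = 1, setting a variable to 0
  selects the walks that end on the corresponding axis.\<close>

definition walk_gf :: "step set \<Rightarrow> 'a::comm_ring_1 \<Rightarrow> 'a \<Rightarrow> 'a fls fps \<Rightarrow> 'a fls fps \<Rightarrow> 'a fls fps"
  where "walk_gf S a b X Z = weighted_sum S a b (walk_monomial X Z)"

definition step_sum :: "step set \<Rightarrow> 'r::comm_ring_1 \<Rightarrow> 'r \<Rightarrow> nat \<times> nat \<Rightarrow> 'r" where
  "step_sum S X Z p = (\<Sum>s\<in>allowed_steps S p. walk_monomial X Z (walk_step p s))"

lemma weighted_sum_add: "weighted_sum S a b (\<lambda>p. F p + G p) = weighted_sum S a b F + weighted_sum S a b G"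
  unfolding weighted_sum_def by (simp add: algebra_simps sum.distrib flip: t_sum_add)

lemma weighted_sum_diff: "weighted_sum S a b (\<lambda>p. F p - G p) = weighted_sum S a b F - weighted_sum S a b G"
  unfolding weighted_sum_def by (simp add: algebra_simps sum_subtractf flip: t_sum_diff)

lemma weighted_sum_mult: "weighted_sum S a b (\<lambda>p. c * F p) = c * weighted_sum S a b F"
  unfolding weighted_sum_def by (simp add: mult_ac sum_distrib_left flip: t_sum_mult)

text \<open>T leaves the vertex reached by the last step unweighted. Its weight is the product of 1
  + (a-1) [y = 0] and 1 + (b-1) [x = 0], and the indicator functions amount to setting Z or X to 0;
  expanding the product gives the four terms.\<close>

lemma walk_gf_step:
  fixes a b :: "'a::comm_ring_1"
  assumes "finite S"
  defines "T \<equiv> \<lambda>X Z. fps_X * weighted_sum S a b (step_sum S X Z)"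
  shows "walk_gf S a b X Z = 1 + T X Z + (scalar a - 1) * T X 0 + (scalar b - 1) * T 0 Z
    + (scalar a - 1) * (scalar b - 1) * T 0 0"
proof -
  let ?c = "\<lambda>p. (if snd p = 0 then scalar a else 1) * (if fst p = 0 then scalar b else 1)"
  have "(if snd p = 0 then A else 1) * (if fst p = 0 then B else 1) * walk_monomial X Z p =
      walk_monomial X Z p + (A - 1) * walk_monomial X 0 p + (B - 1) * walk_monomial 0 Z p
      + (A - 1) * (B - 1) * walk_monomial 0 0 p" for p :: "nat \<times> nat" and A B :: "'a fls fps"
    by (cases "fst p = 0"; cases "snd p = 0") (simp_all add: algebra_simps zero_power)
  note weight = this[of _ "scalar a" "scalar b"]
  have "walk_gf S a b X Z = 1 + fps_X * t_sum (\<lambda>n. \<Sum>v\<in>quarter_plane_walks S (Suc n).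
      scalar (walk_weight a b v) * walk_monomial X Z (walk_end v))"
    unfolding walk_gf_def weighted_sum_def
    by (subst t_sum_rec) (simp add: quarter_plane_walks_0 walk_weight_def walk_end_def vertex_def
        horizontal_visits_def vertical_visits_def)
  also have "t_sum (\<lambda>n. \<Sum>v\<in>quarter_plane_walks S (Suc n).
        scalar (walk_weight a b v) * walk_monomial X Z (walk_end v)) =
      weighted_sum S a b (\<lambda>p. step_sum S X Z p + (scalar a - 1) * step_sum S X 0 p
        + (scalar b - 1) * step_sum S 0 Z p + (scalar a - 1) * (scalar b - 1) * step_sum S 0 0 p)"
    unfolding weighted_sum_def sum_quarter_plane_walks_Suc[OF assms(1)]
  proof (intro arg_cong[of _ _ t_sum] ext sum.cong refl)
    fix n w assume w: "w \<in> quarter_plane_walks S n"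
    have "(\<Sum>s\<in>allowed_steps S (walk_end w).
        scalar (walk_weight a b (w @ [s])) * walk_monomial X Z (walk_end (w @ [s]))) =
      (\<Sum>s\<in>allowed_steps S (walk_end w). scalar (walk_weight a b w) *
         (?c (walk_step (walk_end w) s) * walk_monomial X Z (walk_step (walk_end w) s)))"
    proof (intro sum.cong refl)
      fix s assume s: "s \<in> allowed_steps S (walk_end w)"
      have "scalar (walk_weight a b (w @ [s])) =
          scalar (walk_weight a b w) * ?c (walk_step (walk_end w) s)"
        unfolding walk_weight_append[OF w s] by auto
      thus "scalar (walk_weight a b (w @ [s])) * walk_monomial X Z (walk_end (w @ [s])) =
          scalar (walk_weight a b w) *
          (?c (walk_step (walk_end w) s) * walk_monomial X Z (walk_step (walk_end w) s))"
        by (simp only: walk_end_append[OF w s] mult.assoc)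
    qed
    also have "\<dots> = scalar (walk_weight a b w) * (step_sum S X Z (walk_end w)
        + (scalar a - 1) * step_sum S X 0 (walk_end w) + (scalar b - 1) * step_sum S 0 Z (walk_end w)
        + (scalar a - 1) * (scalar b - 1) * step_sum S 0 0 (walk_end w))"
      unfolding weight step_sum_def sum.distrib sum_distrib_left[symmetric] by (rule refl)
    finally show "(\<Sum>s\<in>allowed_steps S (walk_end w).
        scalar (walk_weight a b (w @ [s])) * walk_monomial X Z (walk_end (w @ [s]))) = \<dots>" .
  qed
  finally show ?thesis
    unfolding weighted_sum_add weighted_sum_mult T_def by (simp only: algebra_simps)
qed

text \<open>Setting variables to 0 in \<open>walk_gf_step\<close> gives a triangular system that
  expresses the boundary values of T by those of Q. Solving it produces \<alpha> and \<beta>, and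
  1/(ab) = 1 - \<alpha> - \<beta> + \<alpha> \<beta>. The assumption on \<open>step_sum\<close> has
  no corner term: it suits step sets without (-1,-1), where the steps forbidden by the two axes are
  disjoint.\<close>

lemma kernel_equation:
  fixes a b :: "'a::field"
  assumes S: "finite S" and ab: "a \<noteq> 0" "b \<noteq> 0"
    and step: "\<And>X Z p. X * Z * step_sum S X Z p =
      K X Z * walk_monomial X Z p - U Z * walk_monomial 0 Z p - V X * walk_monomial X 0 p"
  defines "Q \<equiv> walk_gf S a b"
  defines "\<alpha> \<equiv> scalar (1 - 1 / a)" and "\<beta> \<equiv> scalar (1 - 1 / b)"
  shows "(X * Z - fps_X * K X Z) * Q X Z = (scalar (1 / (a * b)) - \<alpha> * \<beta> * Q 0 0) * (X * Z)
    + (\<alpha> * (X * Z) - fps_X * V X) * Q X 0 + (\<beta> * (X * Z) - fps_X * U Z) * Q 0 Z"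
proof -
  define T where "T = (\<lambda>X Z. fps_X * weighted_sum S a b (step_sum S X Z))"
  let ?a = "scalar a" and ?b = "scalar b"
  have Q: "Q X Z = 1 + T X Z + (?a - 1) * T X 0 + (?b - 1) * T 0 Z + (?a - 1) * (?b - 1) * T 0 0"
    for X Z unfolding Q_def T_def by (rule walk_gf_step) fact
  have QX: "Q X 0 - 1 = ?a * (T X 0 + (?b - 1) * T 0 0)" unfolding Q by algebra
  have QZ: "Q 0 Z - 1 = ?b * (T 0 Z + (?a - 1) * T 0 0)" unfolding Q by algebra
  have Q0: "Q 0 0 - 1 = ?a * ?b * T 0 0" unfolding Q by algebra
  define a' where "a' = scalar (1 / a)"
  define b' where "b' = scalar (1 / b)"
  have a': "a' * ?a = 1" and b': "b' * ?b = 1"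
    using ab by (simp_all add: a'_def b'_def)
  have \<alpha>: "\<alpha> = 1 - a'" and \<beta>: "\<beta> = 1 - b'"
    by (simp_all add: \<alpha>_def \<beta>_def a'_def b'_def fls_minus_const[symmetric] fps_const_sub[symmetric]
        del: fps_const_sub)
  have a'b': "scalar (1 / (a * b)) = a' * b'"
    by (simp add: a'_def b'_def)
  have TX: "(?a - 1) * T X 0 = \<alpha> * (Q X 0 - 1) - (?a - 1) * (?b - 1) * T 0 0"
    unfolding QX \<alpha> using a' by algebra
  have TZ: "(?b - 1) * T 0 Z = \<beta> * (Q 0 Z - 1) - (?a - 1) * (?b - 1) * T 0 0"
    unfolding QZ \<beta> using b' by algebra
  have T0: "(?a - 1) * (?b - 1) * T 0 0 = \<alpha> * \<beta> * (Q 0 0 - 1)"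
    unfolding Q0 \<alpha> \<beta> using a' b' by algebra
  have "X * Z * T X Z = fps_X * weighted_sum S a b (\<lambda>p. X * Z * step_sum S X Z p)"
    by (simp add: T_def weighted_sum_mult mult_ac)
  also have "\<dots> = fps_X * (K X Z * Q X Z - U Z * Q 0 Z - V X * Q X 0)"
    unfolding step weighted_sum_diff weighted_sum_mult Q_def walk_gf_def ..
  finally have T: "X * Z * T X Z = fps_X * (K X Z * Q X Z - U Z * Q 0 Z - V X * Q X 0)" .
  have "X * Z * Q X Z = X * Z * T X Z
      + X * Z * (1 + \<alpha> * (Q X 0 - 1) + \<beta> * (Q 0 Z - 1) - \<alpha> * \<beta> * (Q 0 0 - 1))"
    unfolding Q[of X Z] TX TZ T0 by (simp only: algebra_simps)
  thus ?thesis
    using T unfolding a'b' \<alpha> \<beta> by algebra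
qed

section \<open>Coefficients of the boundary series Q(x,0), Q(0,1/x) and Q(0,0)\<close>

lemma walk_gf_const_nth:
  "walk_gf S a b (fps_const X) (fps_const Z) $ n =
     (\<Sum>w\<in>quarter_plane_walks S n. fls_const (walk_weight a b w) * walk_monomial X Z (walk_end w))"
proof -
  have "(\<Sum>w\<in>quarter_plane_walks S n. scalar (walk_weight a b w) *
          walk_monomial (fps_const X) (fps_const Z) (walk_end w)) =
      fps_const (\<Sum>w\<in>quarter_plane_walks S n.
          fls_const (walk_weight a b w) * walk_monomial X Z (walk_end w))" for n
    by (rule fps_ext) (simp add: fps_sum_nth)
  thus ?thesis
    unfolding walk_gf_def weighted_sum_def by (simp only: t_sum_const fps_nth_Abs_fps)
qed

lemma x_coeff_walk_gf_xvar_0: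
  "x_coeff k (walk_gf S a b xvar 0) = (if k \<ge> 0 then endpoint_gf S a b (nat k, 0) else 0)"
proof (rule fps_ext)
  fix n
  have "walk_gf S a b xvar 0 $ n = (\<Sum>w\<in>quarter_plane_walks S n.
      fls_const (walk_weight a b w) * walk_monomial fls_X 0 (walk_end w))"
    using walk_gf_const_nth[of S a b fls_X 0 n] by (simp add: xvar_def)
  moreover have "(fls_const (walk_weight a b w) * walk_monomial fls_X 0 (walk_end w)) $$ k =
      (if k \<ge> 0 then if walk_end w = (nat k, 0) then walk_weight a b w else 0 else 0)" for w
    by (cases "walk_end w"; cases "fst (walk_end w) = 0"; cases "snd (walk_end w) = 0")
       (auto simp: zero_power)
  ultimately show "x_coeff k (walk_gf S a b xvar 0) $ n =
      (if k \<ge> 0 then endpoint_gf S a b (nat k, 0) else 0) $ n"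
    by (simp add: fls_nth_sum endpoint_gf_def)
qed

lemma x_coeff_walk_gf_0_xinv:
  "x_coeff k (walk_gf S a b 0 xinv) = (if k \<le> 0 then endpoint_gf S a b (0, nat (- k)) else 0)"
proof (rule fps_ext)
  fix n
  have "walk_gf S a b 0 xinv $ n = (\<Sum>w\<in>quarter_plane_walks S n.
      fls_const (walk_weight a b w) * walk_monomial 0 fls_X_inv (walk_end w))"
    using walk_gf_const_nth[of S a b 0 fls_X_inv n] by (simp add: xinv_def)
  moreover have "(fls_const (walk_weight a b w) * walk_monomial 0 fls_X_inv (walk_end w)) $$ k =
      (if k \<le> 0 then if walk_end w = (0, nat (- k)) then walk_weight a b w else 0 else 0)" for w
    by (cases "walk_end w"; cases "fst (walk_end w) = 0"; cases "snd (walk_end w) = 0")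
       (auto simp: zero_power)
  ultimately show "x_coeff k (walk_gf S a b 0 xinv) $ n =
      (if k \<le> 0 then endpoint_gf S a b (0, nat (- k)) else 0) $ n"
    by (simp add: fls_nth_sum endpoint_gf_def)
qed

lemma weighted_sum_indicator:
  "weighted_sum S a b (\<lambda>p. if p = q then 1 else 0) = fps_embed (endpoint_gf S a b q)"
proof -
  have "(\<Sum>w\<in>quarter_plane_walks S n. scalar (walk_weight a b w) * (if walk_end w = q then 1 else 0)) =
      fps_const (fls_const (\<Sum>w\<in>quarter_plane_walks S n.
          if walk_end w = q then walk_weight a b w else 0))" for n
  proof -
    have "scalar c * (if P then 1 else 0) = scalar (if P then c else 0)" for c :: 'a and P
      by simp
    thus ?thesis by (intro fps_ext) (simp add: fps_sum_nth fls_const_sum)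
  qed
  thus ?thesis
    unfolding weighted_sum_def by (intro fps_ext) (simp add: t_sum_const endpoint_gf_def)
qed

lemma walk_gf_0_0: "walk_gf S a b 0 0 = fps_embed (endpoint_gf S a b (0, 0))"
proof -
  have "walk_monomial 0 0 = (\<lambda>p. if p = (0, 0) then 1 else (0 :: 'a fls fps))"
    by (auto simp: fun_eq_iff zero_power power_0_left)
  thus ?thesis
    unfolding walk_gf_def by (simp only: weighted_sum_indicator)
qed

lemma neq_0_if_x_coeff_neq_0:
  assumes "x_coeff k P \<noteq> 0"
  shows "P \<noteq> 0"
  using assms by auto

lemma ratio_of_D_finiteI:
  assumes "D_finite F" "D_finite H" "H \<noteq> 0" "G * H = F"
  shows "ratio_of_D_finite G"
  unfolding ratio_of_D_finite_def
proof (intro exI conjI)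
  have "fps_to_fls G * fps_to_fls H = fps_to_fls F"
    by (simp add: assms(4) flip: fls_times_fps_to_fls)
  moreover have "fps_to_fls H \<noteq> 0"
    using assms(3) by simp
  ultimately show "fps_to_fls G = fps_to_fls F / fps_to_fls H"
    by (simp add: nonzero_eq_divide_eq)
qed (use assms in auto)

section \<open>Model 17\<close>

lemma step_sum_model17:
  "X * Z * step_sum model17 X Z p = (X ^ 2 + X * Z ^ 2 + Z) * walk_monomial X Z p
     - Z * walk_monomial 0 Z p - X ^ 2 * walk_monomial X 0 p"
proof -
  obtain k l where p: "p = (k, l)" by (cases p)
  have "allowed_steps model17 (k, l) = {(0, 1)} \<union> (if k = 0 then {} else {(-1, 0)})
      \<union> (if l = 0 then {} else {(1, -1)})"
    by (auto simp: allowed_steps_def model17_def)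
  thus ?thesis
    unfolding p step_sum_def
    by (cases k; cases l)
       (simp_all add: walk_step_def nat_add_distrib power2_eq_square algebra_simps)
qed

text \<open>The group of the model permutes the three step weights \<open>z\<close>, \<open>1/x\<close>, \<open>x/z\<close>. At a root \<open>z = Y\<close> of the
  kernel, the kernel equations at the orbit points \<open>(x, Y)\<close>, \<open>(Y/x, Y)\<close>, \<open>(Y/x, 1/x)\<close> allow
  one to eliminate the values of \<open>Q\<close> that depend on \<open>Y\<close>; \<open>\<omega>\<close> stands for \<open>t x / Y\<close>.\<close>

lemma model17_boundary_equation:
  fixes a b :: "'a::field_char_0"
  assumes ab: "a \<noteq> 0" "b \<noteq> 0"
  defines "Q \<equiv> walk_gf model17 a b"
  defines "\<alpha> \<equiv> scalar (1 - 1 / a)" and "\<beta> \<equiv> scalar (1 - 1 / b)"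
  shows "\<exists>E. hyperexp_span E \<and>
    (\<alpha> ^ 2 - \<alpha> + \<alpha> * fps_X * xinv + fps_X ^ 2 * xvar) * Q xvar 0
      + (\<alpha> - fps_X * xinv) * (\<beta> - fps_X * xinv) * Q 0 xinv
    = - ((scalar (1 / (a * b)) - \<alpha> * \<beta> * Q 0 0) * E)"
proof -
  define t :: "'a fls fps" where "t = fps_X"
  define x :: "'a fls fps" where "x = xvar"
  define y :: "'a fls fps" where "y = xinv"
  have xy: "x * y = 1" by (simp add: x_def y_def)
  obtain Y where Y: "Y = t * (x + y * Y + 1 * Y ^ 2)"
    unfolding t_def using quadratic_fixed_point_exists by blast
  \<comment> \<open>Y has zero constant term in t and cannot be inverted in K((x))[[t]]. At a kernel
    root the three weighted steps t Y, t/x, t x/Y sum to 1, which defines the third without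
    division.\<close>
  define \<omega> where "\<omega> = 1 - t * y - t * Y"
  have \<omega>Y: "\<omega> * Y = t * x"
    using Y unfolding \<omega>_def by algebra
  have nz: "x \<noteq> 0" "y \<noteq> 0" "Y \<noteq> 0"
    using \<omega>Y by (auto simp: x_def y_def t_def)
  define c where "c = scalar (1 / (a * b)) - \<alpha> * \<beta> * Q 0 0"
  have ke: "(X * Z - t * (X ^ 2 + X * Z ^ 2 + Z)) * Q X Z = c * (X * Z)
    + (\<alpha> * (X * Z) - t * X ^ 2) * Q X 0 + (\<beta> * (X * Z) - t * Z) * Q 0 Z" for X Z
    unfolding Q_def \<alpha>_def \<beta>_def c_def t_def
    by (rule kernel_equation[OF _ ab step_sum_model17]) (simp add: model17_def)
  have "x * Y - t * (x ^ 2 + x * Y ^ 2 + Y) = 0"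
    using Y xy by algebra
  with ke[of x Y] have "(x * Y) * (c + (\<alpha> - \<omega>) * Q x 0 + (\<beta> - t * y) * Q 0 Y) = 0"
    using \<omega>Y xy by algebra
  hence e1: "c + (\<alpha> - \<omega>) * Q x 0 + (\<beta> - t * y) * Q 0 Y = 0"
    using nz by simp
  have "y * Y * Y - t * ((y * Y) ^ 2 + y * Y * Y ^ 2 + Y) = 0"
    using Y xy by algebra
  with ke[of "y * Y" Y]
  have "(y * Y * Y) * (c + (\<alpha> - t * y) * Q (y * Y) 0 + (\<beta> - \<omega>) * Q 0 Y) = 0"
    using \<omega>Y xy by algebra
  hence e2: "c + (\<alpha> - t * y) * Q (y * Y) 0 + (\<beta> - \<omega>) * Q 0 Y = 0"
    using nz by simp
  have "y * Y * y - t * ((y * Y) ^ 2 + y * Y * y ^ 2 + y) = 0"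
    using Y xy by algebra
  with ke[of "y * Y" y]
  have "(y * Y * y) * (c + (\<alpha> - t * Y) * Q (y * Y) 0 + (\<beta> - \<omega>) * Q 0 y) = 0"
    using \<omega>Y xy by algebra
  hence e3: "c + (\<alpha> - t * Y) * Q (y * Y) 0 + (\<beta> - \<omega>) * Q 0 y = 0"
    using nz by simp
  \<comment> \<open>The multipliers below cancel Q(0,Y) between the first two equations and Q(Y/x,0)
    between the last two; N is the resulting coefficient of c.\<close>
  define N where
    "N = (\<beta> - \<omega>) * (\<alpha> - t * Y) - (\<beta> - t * y) * (\<alpha> - t * Y) + (\<beta> - t * y) * (\<alpha> - t * y)"
  have "(\<beta> - \<omega>) * ((\<alpha> - t * Y) * (\<alpha> - \<omega>) * Q x 0 + (\<alpha> - t * y) * (\<beta> - t * y) * Q 0 y) + c * N =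
      (\<beta> - \<omega>) * (\<alpha> - t * Y) * (c + (\<alpha> - \<omega>) * Q x 0 + (\<beta> - t * y) * Q 0 Y)
      - (\<beta> - t * y) * (\<alpha> - t * Y) * (c + (\<alpha> - t * y) * Q (y * Y) 0 + (\<beta> - \<omega>) * Q 0 Y)
      + (\<beta> - t * y) * (\<alpha> - t * y) * (c + (\<alpha> - t * Y) * Q (y * Y) 0 + (\<beta> - \<omega>) * Q 0 y)"
    unfolding N_def by algebra
  also have "\<dots> = 0" by (simp add: e1 e2 e3)
  finally have elim: "(\<beta> - \<omega>) * ((\<alpha> - t * Y) * (\<alpha> - \<omega>) * Q x 0
      + (\<alpha> - t * y) * (\<beta> - t * y) * Q 0 y) + c * N = 0" .
  \<comment> \<open>Only the sum 1 - t/x and the product t^2 x of t Y and \<omega> enter, so Y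
    disappears.\<close>
  have coeff: "(\<alpha> - t * Y) * (\<alpha> - \<omega>) = \<alpha> ^ 2 - \<alpha> + \<alpha> * t * y + t ^ 2 * x"
    using \<omega>Y unfolding \<omega>_def by algebra
  define v where "v = inverse (\<beta> - \<omega>)"
  \<comment> \<open>At t = 0 one has \<omega> = 1, so the constant term is \<beta> - 1 =
    -1/b.\<close>
  have "(\<beta> - \<omega>) $ 0 \<noteq> 0"
    using ab by (simp add: \<beta>_def \<omega>_def t_def)
  hence v: "(\<beta> - \<omega>) * v = 1"
    unfolding v_def by (rule inverse_mult_eq_1')
  have main: "(\<alpha> ^ 2 - \<alpha> + \<alpha> * t * y + t ^ 2 * x) * Q x 0
      + (\<alpha> - t * y) * (\<beta> - t * y) * Q 0 y = - (c * (N * v))"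
    using elim v unfolding coeff by algebra
  have span: "hyperexp_span x" "hyperexp_span y" "hyperexp_span t" "hyperexp_span \<alpha>" "hyperexp_span \<beta>"
    unfolding x_def y_def t_def \<alpha>_def \<beta>_def by (intro span_intros)+
  have poly: "is_poly x" "is_poly t" "is_poly \<beta>"
    unfolding x_def t_def \<beta>_def by (intro poly_intros)+
  have spanY: "hyperexp_span Y"
  proof (rule hyperexp_span_quadratic)
    show "t * x * Y ^ 2 + (t - x) * Y + t * x ^ 2 = 0"
      using Y xy by algebra
    show "t * x \<noteq> 0" using nz by (simp add: t_def)
  qed (intro poly_intros poly)+
  have spanv: "hyperexp_span v"
  proof (rule hyperexp_span_inverse[OF v])
    \<comment> \<open>The conjugate of \<beta> - \<omega> is \<beta> - t Y; the factor x clears the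
      remaining 1/x.\<close>
    show P: "(\<beta> - \<omega>) * (x * (\<beta> - t * Y)) = x * (\<beta> ^ 2 - \<beta>) + \<beta> * t + x * (x * t ^ 2)"
      using \<omega>Y xy unfolding \<omega>_def by algebra
    show "hyperexp_span (x * (\<beta> - t * Y))"
      by (intro span_intros span spanY)
    show "is_poly (x * (\<beta> ^ 2 - \<beta>) + \<beta> * t + x * (x * t ^ 2))"
      by (intro poly_intros poly)
    have eq: "\<beta> = fps_embed (fps_const (1 - 1 / b))" "t = fps_embed fps_X"
      by (simp_all add: \<beta>_def t_def fps_embed_const)
    have "x_coeff 2 (x * (\<beta> ^ 2 - \<beta>) + \<beta> * t + x * (x * t ^ 2)) = fps_X ^ 2"
      unfolding eq x_def
      by (simp only: x_coeff_add x_coeff_xvar_mult x_coeff_embed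
            flip: fps_embed_power fps_embed_mult fps_embed_diff) simp
    thus "x * (\<beta> ^ 2 - \<beta>) + \<beta> * t + x * (x * t ^ 2) \<noteq> 0"
      by (intro neq_0_if_x_coeff_neq_0[of 2]) simp
  qed
  have "hyperexp_span (N * v)"
    unfolding N_def \<omega>_def by (intro span_intros span spanY spanv)
  with main show ?thesis
    unfolding c_def x_def y_def t_def by blast
qed

text \<open>The constant term after division by 1 - z/x is (\<rho> + \<alpha> \<beta>) G on the
  left. The condition a \<noteq> 1 gives p a small root z, and 1/a + 1/b \<noteq> 1 makes \<rho> +
  \<alpha> \<beta> a unit. Dividing by it inside the span keeps everything a single constant
  term.\<close>

lemma model17_excursion_gf_equation:
  fixes a b :: "'a::field_char_0"
  assumes ab: "a \<noteq> 0" "b \<noteq> 0" "a \<noteq> 1" "1 / a + 1 / b \<noteq> 1"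
  defines "G \<equiv> endpoint_gf model17 a b (0, 0)"
  shows "\<exists>\<Phi>. hyperexp_span \<Phi> \<and>
    G = - ((fps_const (1 / (a * b)) - fps_const ((1 - 1 / a) * (1 - 1 / b)) * G) * x_coeff 0 \<Phi>)"
proof -
  define Q where "Q = walk_gf model17 a b"
  define al be where "al = 1 - 1 / a" and "be = 1 - 1 / b"
  define \<alpha> \<beta> where "\<alpha> = scalar al" and "\<beta> = scalar be"
  have sum: "1 / a + 1 / b = 2 - (al + be)" by (simp add: al_def be_def)
  have al: "al \<noteq> 0" "al \<noteq> 1" "al + be \<noteq> 1"
    using ab(1,3) ab(4)[unfolded sum] by (auto simp: al_def)
  define t :: "'a fls fps" where "t = fps_X"
  define x :: "'a fls fps" where "x = xvar"
  define y :: "'a fls fps" where "y = xinv"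
  have xy: "x * y = 1" by (simp add: x_def y_def)
  have G: "Q 0 0 = fps_embed G"
    unfolding Q_def G_def by (rule walk_gf_0_0)
  obtain E where E: "hyperexp_span E" "(\<alpha> ^ 2 - \<alpha> + \<alpha> * t * y + t ^ 2 * x) * Q x 0
      + (\<alpha> - t * y) * (\<beta> - t * y) * Q 0 y = - ((scalar (1 / (a * b)) - \<alpha> * \<beta> * Q 0 0) * E)"
    using model17_boundary_equation[OF ab(1,2)]
    unfolding Q_def \<alpha>_def \<beta>_def al_def be_def t_def x_def y_def by blast
  \<comment> \<open>This is x p = 0, that is (\<alpha>^2 - \<alpha>) x + \<alpha> t + t^2 x^2 = 0,
    solved for its linear term; its solution in x is z.\<close>
  obtain z where "z = fps_X * (fps_const (- 1 / (al - 1)) + 0 * z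
      + (- fps_const (1 / (al ^ 2 - al)) * fps_X) * z ^ 2)"
    using quadratic_fixed_point_exists by blast
  hence "fps_const (al ^ 2 - al) * z = fps_const (al ^ 2 - al) * \<dots>" by simp
  also have "\<dots> = - (fps_const ((al ^ 2 - al) / (al - 1)) * fps_X)
      - fps_const ((al ^ 2 - al) / (al ^ 2 - al)) * fps_X ^ 2 * z ^ 2"
    by (simp add: algebra_simps power2_eq_square fps_const_neg[symmetric] del: fps_const_neg)
  also have "(al ^ 2 - al) / (al - 1) = al"
    using al by (simp add: power2_eq_square divide_simps) (simp add: algebra_simps)
  also have "(al ^ 2 - al) / (al ^ 2 - al) = 1"
    using al by (simp add: power2_eq_square)
  finally have z: "fps_const (al ^ 2 - al) * z = - (fps_const al * fps_X) - fps_X ^ 2 * z ^ 2"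
    by simp
  \<comment> \<open>The second factor of p: comparing coefficients in p = (1 - z/x) (\<rho> + t^2 x)
    forces this value.\<close>
  define \<rho> where "\<rho> = fps_const (al ^ 2 - al) + fps_X ^ 2 * z"
  have z\<rho>: "z * \<rho> = - (fps_const al * fps_X)"
    using z unfolding \<rho>_def by algebra
  have "(z * \<rho>) $ 0 = 0" unfolding z\<rho> by simp
  hence z0: "z $ 0 = 0"
    using al by (auto simp: \<rho>_def power2_eq_square)
  obtain u where u: "(1 - fps_embed z * y) * u = 1" "x_nonpos u" "x_coeff 0 u = 1"
    using x_nonpos_geometric[OF z0] unfolding y_def by blast
  let ?z = "fps_embed z" and ?\<rho> = "fps_embed \<rho>"
  have \<alpha>\<alpha>: "fps_embed (fps_const (al ^ 2 - al)) = \<alpha> ^ 2 - \<alpha>"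
    by (simp only: \<alpha>_def fps_const_sub[symmetric] fps_embed_diff fps_embed_const) (simp add: power2_eq_square)
  have \<rho>: "?\<rho> = \<alpha> ^ 2 - \<alpha> + t ^ 2 * ?z"
    unfolding \<rho>_def by (simp add: fps_embed_add fps_embed_mult fps_embed_power \<alpha>\<alpha> t_def)
  have z\<rho>': "?z * ?\<rho> = - (\<alpha> * t)"
    using arg_cong[OF z\<rho>, of fps_embed]
    by (simp add: fps_embed_mult fps_embed_uminus \<alpha>_def fps_embed_const t_def)
  have factor: "\<alpha> ^ 2 - \<alpha> + \<alpha> * t * y + t ^ 2 * x = (1 - ?z * y) * (?\<rho> + t ^ 2 * x)"
    using \<rho> z\<rho>' xy by algebra
  have eq: "?\<rho> * Q x 0 + x * (t ^ 2 * Q x 0) + (\<alpha> - t * y) * (\<beta> - t * y) * Q 0 y * u =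
      - ((scalar (1 / (a * b)) - \<alpha> * \<beta> * Q 0 0) * (E * u))"
    using E(2) u(1) unfolding factor by algebra
  have CT1: "x_coeff 0 (?\<rho> * Q x 0) = \<rho> * G"
    unfolding Q_def x_def G_def x_coeff_embed_mult x_coeff_walk_gf_xvar_0 by simp
  have "t ^ 2 = fps_embed (fps_X ^ 2)" by (simp add: t_def fps_embed_power)
  hence CT2: "x_coeff 0 (x * (t ^ 2 * Q x 0)) = 0"
    unfolding Q_def x_def by (simp only: x_coeff_xvar_mult x_coeff_embed_mult x_coeff_walk_gf_xvar_0) simp
  have nonpos_linear: "x_nonpos (scalar c - t * y) \<and> x_coeff 0 (scalar c - t * y) = fps_const c" for c
  proof -
    have "scalar c - t * y = fps_embed (fps_const c) - xinv * fps_embed fps_X"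
      by (simp add: t_def y_def fps_embed_const mult.commute)
    hence "x_coeff k (scalar c - t * y) = (if k = 0 then fps_const c else 0) - (if k = -1 then fps_X else 0)" for k
      by (simp only: x_coeff_diff x_coeff_xinv_mult x_coeff_embed) auto
    thus ?thesis by (simp add: x_nonpos_def)
  qed
  have nonpos_Q: "x_nonpos (Q 0 y)" "x_coeff 0 (Q 0 y) = G"
    unfolding x_nonpos_def Q_def y_def x_coeff_walk_gf_0_xinv G_def by auto
  have CT3: "x_coeff 0 ((\<alpha> - t * y) * (\<beta> - t * y) * Q 0 y * u) = fps_const (al * be) * G"
    using nonpos_linear[of al] nonpos_linear[of be] nonpos_Q u(2,3) unfolding \<alpha>_def \<beta>_def
    by (simp add: x_coeff_0_mult_nonpos x_nonpos_mult)
  have "scalar (1 / (a * b)) - \<alpha> * \<beta> * Q 0 0 = fps_embed (fps_const (1 / (a * b)) - fps_const (al * be) * G)"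
    unfolding G by (simp add: \<alpha>_def \<beta>_def fps_embed_diff fps_embed_mult fps_embed_const)
  hence "x_coeff 0 (- ((scalar (1 / (a * b)) - \<alpha> * \<beta> * Q 0 0) * (E * u))) =
      - ((fps_const (1 / (a * b)) - fps_const (al * be) * G) * x_coeff 0 (E * u))"
    by (simp only: x_coeff_uminus x_coeff_embed_mult)
  with arg_cong[OF eq, of "x_coeff 0"]
  have eq': "\<rho> * G + fps_const (al * be) * G =
      - ((fps_const (1 / (a * b)) - fps_const (al * be) * G) * x_coeff 0 (E * u))"
    unfolding x_coeff_add CT1 CT2 CT3 by simp
  define \<sigma> where "\<sigma> = \<rho> + fps_const (al * be)"
  define r where "r = inverse \<sigma>"
  have "\<sigma> $ 0 = al * (al + be - 1)"
    by (simp add: \<sigma>_def \<rho>_def power2_eq_square algebra_simps)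
  hence "\<sigma> $ 0 \<noteq> 0" using al by simp
  hence r: "\<sigma> * r = 1" unfolding r_def by (rule inverse_mult_eq_1')
  have "G = - ((fps_const (1 / (a * b)) - fps_const (al * be) * G) * (r * x_coeff 0 (E * u)))"
    using eq' r unfolding \<sigma>_def by algebra
  hence "G = - ((fps_const (1 / (a * b)) - fps_const (al * be) * G) *
      x_coeff 0 (fps_embed r * (E * u)))"
    by (simp only: x_coeff_embed_mult)
  moreover have "hyperexp_span (fps_embed r * (E * u))"
  proof -
    have span: "hyperexp_span x" "hyperexp_span t" "hyperexp_span \<alpha>" "hyperexp_span \<beta>"
      unfolding x_def t_def \<alpha>_def \<beta>_def by (intro span_intros)+
    have poly: "is_poly x" "is_poly t" "is_poly \<alpha>" "is_poly \<beta>"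
      unfolding x_def t_def \<alpha>_def \<beta>_def by (intro poly_intros)+
    have span\<rho>: "hyperexp_span ?\<rho>"
    proof (rule hyperexp_span_quadratic)
      show "1 * ?\<rho> ^ 2 + (\<alpha> - \<alpha> ^ 2) * ?\<rho> + \<alpha> * t ^ 3 = 0"
        using \<rho> z\<rho>' by algebra
    qed (intro poly_intros poly | simp)+
    have embed: "\<alpha> = fps_embed (fps_const al)" "\<beta> = fps_embed (fps_const be)" "t = fps_embed fps_X"
      by (simp_all add: \<alpha>_def \<beta>_def t_def fps_embed_const)
    have "hyperexp_span u"
    proof (rule hyperexp_span_inverse[OF u(1)])
      \<comment> \<open>The other Wiener-Hopf factor plays the role of the conjugate, and the norm
        is x p.\<close>
      show "(1 - ?z * y) * (x * (?\<rho> + t ^ 2 * x)) = x * (\<alpha> ^ 2 - \<alpha>) + \<alpha> * t + x * (x * t ^ 2)"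
        using factor xy by algebra
      show "is_poly (x * (\<alpha> ^ 2 - \<alpha>) + \<alpha> * t + x * (x * t ^ 2))"
        by (intro poly_intros poly)
      show "hyperexp_span (x * (?\<rho> + t ^ 2 * x))"
        by (intro span_intros span span\<rho>)
      have "x_coeff 2 (x * (\<alpha> ^ 2 - \<alpha>) + \<alpha> * t + x * (x * t ^ 2)) = fps_X ^ 2"
        unfolding embed x_def
        by (simp only: x_coeff_add x_coeff_xvar_mult x_coeff_embed
              flip: fps_embed_power fps_embed_mult fps_embed_diff) simp
      thus "x * (\<alpha> ^ 2 - \<alpha>) + \<alpha> * t + x * (x * t ^ 2) \<noteq> 0"
        by (intro neq_0_if_x_coeff_neq_0[of 2]) simp
    qed
    moreover have "hyperexp_span (fps_embed r)"
    proof (rule hyperexp_span_inverse)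
      have \<sigma>: "fps_embed \<sigma> = ?\<rho> + \<alpha> * \<beta>"
        by (simp add: \<sigma>_def fps_embed_add embed flip: fps_embed_mult)
      show "fps_embed \<sigma> * fps_embed r = 1"
        by (simp add: r flip: fps_embed_mult)
      \<comment> \<open>\<alpha>^2 - \<alpha> - \<rho> is the other root of the quadratic equation
        for \<rho>. The product of the two roots is \<alpha> t^3, and this term keeps the norm from
        vanishing.\<close>
      show "fps_embed \<sigma> * (\<alpha> ^ 2 - \<alpha> - ?\<rho> + \<alpha> * \<beta>) =
          \<alpha> * t ^ 3 + \<alpha> * \<beta> * (\<alpha> ^ 2 - \<alpha>) + (\<alpha> * \<beta>) ^ 2"
        using \<rho> z\<rho>' unfolding \<sigma> by algebra
      show "is_poly (\<alpha> * t ^ 3 + \<alpha> * \<beta> * (\<alpha> ^ 2 - \<alpha>) + (\<alpha> * \<beta>) ^ 2)"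
        by (intro poly_intros poly)
      show "hyperexp_span (\<alpha> ^ 2 - \<alpha> - ?\<rho> + \<alpha> * \<beta>)"
        by (intro span_intros span span\<rho>)
      have "(fps_const al * fps_X ^ 3 + fps_const al * fps_const be * (fps_const al ^ 2 - fps_const al)
          + (fps_const al * fps_const be) ^ 2) $ 3 \<noteq> 0"
        using al by (simp add: fps_power_zeroth_eq_one numeral_eq_Suc)
      hence "fps_embed (fps_const al * fps_X ^ 3 + fps_const al * fps_const be *
          (fps_const al ^ 2 - fps_const al) + (fps_const al * fps_const be) ^ 2) \<noteq> 0"
        by (metis fps_embed_inj fps_embed_0 fps_zero_nth)
      thus "\<alpha> * t ^ 3 + \<alpha> * \<beta> * (\<alpha> ^ 2 - \<alpha>) + (\<alpha> * \<beta>) ^ 2 \<noteq> 0"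
        unfolding embed by (simp only: fps_embed_power fps_embed_mult fps_embed_diff fps_embed_add not_False_eq_True)
    qed
    ultimately show ?thesis
      by (intro span_intros E(1))
  qed
  ultimately show ?thesis unfolding al_def be_def by blast
qed

section \<open>Model 17: from the linear equation to the three claims\<close>

lemma finite_model17: "finite model17" and finite_model18: "finite model18"
  by (simp_all add: model17_def model18_def)

lemma hyperexp_span_constant_term_D_finite:
  fixes f :: "'a::field_char_0 fls fps"
  assumes "hyperexp_span f"
  shows "D_finite (x_coeff 0 f)"
  using hyperexp_span_coeff_D_finite[OF assms, of 0] by simp

lemma model17_ratio_of_D_finite:
  fixes a b :: "'a::field_char_0"
  assumes "a \<noteq> 0" "b \<noteq> 0" "a \<noteq> 1" "1 / a + 1 / b \<noteq> 1"
  shows "ratio_of_D_finite (excursion_gf model17 a b)"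
proof -
  define G where "G = excursion_gf model17 a b"
  define c d where "c = 1 / (a * b)" and "d = (1 - 1 / a) * (1 - 1 / b)"
  obtain \<Phi> where \<Phi>: "hyperexp_span \<Phi>"
    and G: "G = - ((fps_const c - fps_const d * G) * x_coeff 0 \<Phi>)"
    using model17_excursion_gf_equation[OF assms]
    unfolding G_def c_def d_def excursion_gf_eq_endpoint_gf[OF finite_model17] by blast
  define F H where "F = x_coeff 0 (- (scalar c * \<Phi>))" and "H = x_coeff 0 (1 - scalar d * \<Phi>)"
  have F: "F = - (fps_const c * x_coeff 0 \<Phi>)" and H: "H = 1 - fps_const d * x_coeff 0 \<Phi>"
    using x_coeff_embed[of 0 1]
    by (simp_all add: F_def H_def x_coeff_uminus x_coeff_diff x_coeff_embed_mult flip: fps_embed_const)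
  have GH: "G * H = F"
    using G unfolding F H by algebra
  have "c \<noteq> 0" using assms by (simp add: c_def)
  \<comment> \<open>H = 0 would give F = G H = 0, so the constant term of \<Phi> would vanish and H
    would be 1.\<close>
  have "H \<noteq> 0"
  proof
    assume "H = 0"
    with GH have "F = 0" by simp
    with \<open>c \<noteq> 0\<close> have "x_coeff 0 \<Phi> = 0" by (simp add: F)
    with \<open>H = 0\<close> show False by (simp add: H)
  qed
  moreover have "D_finite F" "D_finite H"
    unfolding F_def H_def by (intro hyperexp_span_constant_term_D_finite span_intros \<Phi>)+
  ultimately show ?thesis
    using GH unfolding G_def by (intro ratio_of_D_finiteI)
qed

text \<open>For b = 1 the coefficient (1 - 1/a) (1 - 1/b) of G on the right-hand side is 0, so G
  itself is a multiple of one constant term and no quotient arises.\<close>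

lemma model17_D_finite_b_eq_1:
  fixes a :: "'a::field_char_0"
  assumes "a \<noteq> 0" "a \<noteq> 1"
  shows "D_finite (excursion_gf model17 a 1)"
proof -
  obtain \<Phi> where \<Phi>: "hyperexp_span \<Phi>"
    and G: "excursion_gf model17 a 1 = - (fps_const (1 / a) * x_coeff 0 \<Phi>)"
    using model17_excursion_gf_equation[of a 1] assms
    unfolding excursion_gf_eq_endpoint_gf[OF finite_model17] by auto
  have "x_coeff 0 (- (scalar (1 / a) * \<Phi>)) = excursion_gf model17 a 1"
    by (simp only: G x_coeff_uminus x_coeff_embed_mult flip: fps_embed_const)
  moreover have "hyperexp_span (- (scalar (1 / a) * \<Phi>))"
    by (intro span_intros \<Phi>)
  ultimately show ?thesis
    using hyperexp_span_constant_term_D_finite by metis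
qed

text \<open>For a = 1 the coefficient p shrinks to t^2 x and c to 1/b. The coefficient of x^1 then
  isolates t^2 G, because the term with Q(0,1/x) has no positive powers.\<close>

lemma model17_D_finite_a_eq_1:
  fixes b :: "'a::field_char_0"
  assumes "b \<noteq> 0"
  shows "D_finite (excursion_gf model17 1 b)"
proof -
  define Q where "Q = walk_gf model17 1 b"
  define \<beta> where "\<beta> = scalar (1 - 1 / b)"
  define t :: "'a fls fps" where "t = fps_X"
  define x :: "'a fls fps" where "x = xvar"
  define y :: "'a fls fps" where "y = xinv"
  obtain E where E: "hyperexp_span E"
    "t ^ 2 * x * Q x 0 - t * y * (\<beta> - t * y) * Q 0 y = - (scalar (1 / b) * E)"
    using model17_boundary_equation[of 1 b] assms
    unfolding Q_def \<beta>_def t_def x_def y_def by auto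
  \<comment> \<open>As Q(0,1/x) starts with 1, the left-hand side becomes divisible by t^2 once the
    explicit term - \<beta> t/x is moved away. \<open>\<Phi>\<close> is the quotient, and dividing
    inside the span gives G instead of t^2 G.\<close>
  define R where "R = fps_shift 1 (Q 0 y)"
  have "Q 0 y $ 0 = 1"
    using walk_gf_const_nth[of model17 1 b 0 fls_X_inv 0]
    by (simp add: Q_def y_def xinv_def quarter_plane_walks_0 walk_weight_def walk_end_def
        vertex_def horizontal_visits_def vertical_visits_def)
  hence Q_R: "Q 0 y = 1 + t * R"
    unfolding R_def t_def by (intro fps_ext) (simp add: fps_X_mult_nth)
  define \<Phi> where "\<Phi> = x * Q x 0 + y * (y * Q 0 y) - fps_embed (fps_const (1 - 1 / b)) * (y * R)"
  have \<beta>: "fps_embed (fps_const (1 - 1 / b)) = \<beta>"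
    by (simp add: \<beta>_def fps_embed_const)
  have "t ^ 2 * \<Phi> = - (scalar (1 / b) * E) + \<beta> * t * y"
    unfolding \<Phi>_def \<beta> E(2)[symmetric] Q_R by algebra
  moreover have "hyperexp_span (- (scalar (1 / b) * E) + \<beta> * t * y)"
    unfolding \<beta>_def t_def y_def by (intro span_intros E(1))
  moreover have "is_poly (t ^ 2)" "t ^ 2 \<noteq> 0"
    unfolding t_def by (intro poly_intros, simp)
  ultimately have "hyperexp_span \<Phi>"
    by (metis hyperexp_span_cancel)
  hence "D_finite (x_coeff (int 1) \<Phi>)"
    by (rule hyperexp_span_coeff_D_finite)
  also have "x_coeff (int 1) \<Phi> = excursion_gf model17 1 b"
  proof -
    have "x_coeff 1 (x * Q x 0) = excursion_gf model17 1 b"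
      by (simp add: x_def Q_def x_coeff_xvar_mult x_coeff_walk_gf_xvar_0
          excursion_gf_eq_endpoint_gf finite_model17)
    moreover have "x_coeff 1 (y * (y * Q 0 y)) = 0"
      by (simp add: y_def Q_def x_coeff_xinv_mult x_coeff_walk_gf_0_xinv)
    moreover have "x_coeff 1 (y * R) = 0"
    proof -
      have "x_coeff 2 (Q 0 y) = 0"
        by (simp add: y_def Q_def x_coeff_walk_gf_0_xinv)
      hence "Q 0 y $ n $$ 2 = 0" for n
        by (metis x_coeff_nth fps_zero_nth)
      hence "x_coeff 2 R = 0"
        by (intro fps_ext) (simp add: R_def)
      thus ?thesis
        unfolding y_def x_coeff_xinv_mult by simp
    qed
    ultimately show ?thesis
      by (simp add: \<Phi>_def x_coeff_add x_coeff_diff x_coeff_embed_mult)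
  qed
  finally show ?thesis .
qed

section \<open>Model 18\<close>

lemma allowed_steps_model18:
  "allowed_steps model18 (k, l) = {(1, 0), (0, 1)}
      \<union> (if k = 0 then {} else {(-1, 0), (-1, 1)}) \<union> (if l = 0 then {} else {(0, -1), (1, -1)})"
  by (auto simp: allowed_steps_def model18_def)

lemma step_sum_model18:
  "X * Z * step_sum model18 X Z p =
     (X ^ 2 * Z + Z + X * Z ^ 2 + X + X ^ 2 + Z ^ 2) * walk_monomial X Z p
     - (Z + Z ^ 2) * walk_monomial 0 Z p - (X + X ^ 2) * walk_monomial X 0 p"
proof -
  obtain k l where p: "p = (k, l)" by (cases p)
  show ?thesis
    unfolding p step_sum_def allowed_steps_model18
    by (cases k; cases l)
       (simp_all add: walk_step_def nat_add_distrib power2_eq_square algebra_simps)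
qed

lemma step_sum_model18_0_0:
  "step_sum model18 0 0 p = (if p = (1, 0) then 1 else 0) + (if p = (0, 1) then 1 else 0)"
proof -
  obtain k l where p: "p = (k, l)" by (cases p)
  show ?thesis
    unfolding p step_sum_def allowed_steps_model18
    by (cases k; cases l) (auto simp: walk_step_def nat_add_distrib power_0_left)
qed

text \<open>The origin can be entered only from (1,0) and (0,1), each time with weight a^2. The
  coefficients of x^0 and x^1 in the boundary relation bring in the series of these two neighbours;
  this relation removes them again.\<close>

lemma model18_last_step:
  fixes a :: "'a::comm_ring_1"
  shows "endpoint_gf model18 a a (0, 0) = 1 + fps_const (a ^ 2) * fps_X *
           (endpoint_gf model18 a a (1, 0) + endpoint_gf model18 a a (0, 1))"
proof (rule fps_embed_inj)
  define T where "T = fps_X * weighted_sum model18 a a (step_sum model18 0 0)"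
  have "weighted_sum model18 a a (step_sum model18 0 0) =
      fps_embed (endpoint_gf model18 a a (1, 0) + endpoint_gf model18 a a (0, 1))"
    unfolding step_sum_model18_0_0[abs_def]
    by (simp only: weighted_sum_add weighted_sum_indicator fps_embed_add)
  hence T: "T = fps_X * fps_embed (endpoint_gf model18 a a (1, 0) + endpoint_gf model18 a a (0, 1))"
    by (simp only: T_def)
  have "1 + T + (c - 1) * T + (c - 1) * T + (c - 1) * (c - 1) * T = 1 + c ^ 2 * T" for c
    by (simp add: algebra_simps power2_eq_square)
  hence "walk_gf model18 a a 0 0 = 1 + scalar a ^ 2 * T"
    unfolding walk_gf_step[OF finite_model18] T_def[symmetric] by blast
  thus "fps_embed (endpoint_gf model18 a a (0, 0)) = fps_embed (1 + fps_const (a ^ 2) * fps_X *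
           (endpoint_gf model18 a a (1, 0) + endpoint_gf model18 a a (0, 1)))"
    unfolding walk_gf_0_0 T
    by (simp add: fps_embed_add fps_embed_mult fps_embed_const power2_eq_square mult_ac)
qed

text \<open>As for Model 17, with the orbit points \<open>(x, Y)\<close>, \<open>(Y/x, Y)\<close>, \<open>(Y/x, 1/x)\<close>; here \<open>\<omega>\<close> stands for
  \<open>t (1 + x) / Y\<close> and \<open>\<theta>\<close> for \<open>t x / Y\<close>.\<close>

lemma model18_boundary_equation:
  fixes a :: "'a::field_char_0"
  assumes a: "a \<noteq> 0"
  defines "Q \<equiv> walk_gf model18 a a"
  defines "\<alpha> \<equiv> scalar (1 - 1 / a)"
  defines "\<kappa> \<equiv> 1 + 2 * fps_X - \<alpha>"
  shows "\<exists>E. hyperexp_span E \<and>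
    (\<alpha> * (\<alpha> + fps_X) - \<alpha> * \<kappa> * xvar + fps_X * \<kappa> * xvar ^ 2) * Q xvar 0
      + (\<alpha> * (\<alpha> + fps_X) * xvar - \<alpha> * \<kappa> + fps_X * \<kappa> * xinv) * Q 0 xinv
    = - ((scalar (1 / (a * a)) - \<alpha> * \<alpha> * Q 0 0) * E)"
proof -
  define t :: "'a fls fps" where "t = fps_X"
  define x :: "'a fls fps" where "x = xvar"
  define y :: "'a fls fps" where "y = xinv"
  have xy: "x * y = 1" by (simp add: x_def y_def)
  obtain Y where Y: "Y = t * ((1 + x) + (x + y) * Y + (1 + y) * Y ^ 2)"
    unfolding t_def using quadratic_fixed_point_exists by blast
  \<comment> \<open>1 + x is a unit of K((x)); its inverse \<open>w\<close> is expanded in ascending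
    powers of x.\<close>
  have "(1 + fls_X :: 'a fls) $$ 0 = 1" by simp
  hence "(1 + fls_X :: 'a fls) \<noteq> 0" by (metis fls_zero_nth zero_neq_one)
  hence w1: "(1 + x) * fps_const (inverse (1 + fls_X)) = 1"
    by (simp add: x_def xvar_def fps_const_add[symmetric] fps_const_mult[symmetric]
          fps_const_1_eq_1[symmetric] distrib_right[symmetric]
          del: fps_const_add fps_const_mult fps_const_1_eq_1)
  define w where "w = fps_const (inverse (1 + fls_X :: 'a fls))"
  have w: "(1 + x) * w = 1" unfolding w_def by (rule w1)
  define \<omega> where "\<omega> = 1 - t * (x + y) - t * (1 + y) * Y"
  \<comment> \<open>Again a substitute for a division by Y: \<omega> is t (1 + x)/Y, so x/(1 + x)
    times it is t x/Y.\<close>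
  define \<theta> where "\<theta> = x * w * \<omega>"
  have \<omega>Y: "\<omega> * Y = t * (1 + x)"
    using Y unfolding \<omega>_def by algebra
  have \<theta>Y: "\<theta> * Y = t * x"
    using \<omega>Y w unfolding \<theta>_def by algebra
  have \<theta>: "(1 + x) * (\<theta> + t * Y) = x - t * x ^ 2 - t"
    using w xy unfolding \<theta>_def \<omega>_def by algebra
  have nz: "x \<noteq> 0" "y \<noteq> 0" "Y \<noteq> 0"
    using \<theta>Y by (auto simp: x_def y_def t_def)
  define c where "c = scalar (1 / (a * a)) - \<alpha> * \<alpha> * Q 0 0"
  have ke: "(X * Z - t * (X ^ 2 * Z + Z + X * Z ^ 2 + X + X ^ 2 + Z ^ 2)) * Q X Z = c * (X * Z)
    + (\<alpha> * (X * Z) - t * (X + X ^ 2)) * Q X 0 + (\<alpha> * (X * Z) - t * (Z + Z ^ 2)) * Q 0 Z" for X Z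
    unfolding Q_def \<alpha>_def c_def t_def
    by (rule kernel_equation[OF finite_model18 a a step_sum_model18])
  have "x * Y - t * (x ^ 2 * Y + Y + x * Y ^ 2 + x + x ^ 2 + Y ^ 2) = 0"
    using Y xy by algebra
  with ke[of x Y] have "(x * Y) * (c + (\<alpha> - \<omega>) * Q x 0 + (\<alpha> - t * y * (1 + Y)) * Q 0 Y) = 0"
    using \<omega>Y xy by algebra
  hence e1: "c + (\<alpha> - \<omega>) * Q x 0 + (\<alpha> - t * y * (1 + Y)) * Q 0 Y = 0"
    using nz by simp
  have "y * Y * Y - t * ((y * Y) ^ 2 * Y + Y + y * Y * Y ^ 2 + y * Y + (y * Y) ^ 2 + Y ^ 2) = 0"
    using Y xy by algebra
  with ke[of "y * Y" Y]
  have "(y * Y * Y) * (c + (\<alpha> - (\<theta> * y + t * y)) * Q (y * Y) 0 + (\<alpha> - (\<theta> + t * x)) * Q 0 Y) = 0"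
    using \<theta>Y xy by algebra
  hence e2: "c + (\<alpha> - (\<theta> * y + t * y)) * Q (y * Y) 0 + (\<alpha> - (\<theta> + t * x)) * Q 0 Y = 0"
    using nz by simp
  have "y * Y * y - t * ((y * Y) ^ 2 * y + y + y * Y * y ^ 2 + y * Y + (y * Y) ^ 2 + y ^ 2) = 0"
    using Y xy by algebra
  with ke[of "y * Y" y]
  have "(y * Y * y) * (c + (\<alpha> - (t * x + t * Y)) * Q (y * Y) 0 + (\<alpha> - \<omega>) * Q 0 y) = 0"
    using \<omega>Y xy by algebra
  hence e3: "c + (\<alpha> - (t * x + t * Y)) * Q (y * Y) 0 + (\<alpha> - \<omega>) * Q 0 y = 0"
    using nz by simp
  define A1 A2 A3 A4 where "A1 = \<alpha> - (\<theta> + t * x)" and "A2 = \<alpha> - (t * x + t * Y)"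
    and "A3 = \<alpha> - t * y * (1 + Y)" and "A4 = \<alpha> - (\<theta> * y + t * y)"
  \<comment> \<open>The elimination follows Model 17; the additional factor 1 + x clears the
    denominator of \<theta> + t Y.\<close>
  define N where "N = (1 + x) * (A1 * A2 - A3 * A2 + A3 * A4)"
  have "(\<alpha> - \<omega>) * ((1 + x) * (A1 * A2) * Q x 0 + (1 + x) * (A3 * A4) * Q 0 y) + c * N =
      (1 + x) * (A1 * A2 * (c + (\<alpha> - \<omega>) * Q x 0 + A3 * Q 0 Y)
      - A3 * A2 * (c + A4 * Q (y * Y) 0 + A1 * Q 0 Y)
      + A3 * A4 * (c + A2 * Q (y * Y) 0 + (\<alpha> - \<omega>) * Q 0 y))"
    unfolding N_def by algebra
  also have "\<dots> = 0" unfolding A1_def A2_def A3_def A4_def by (simp add: e1 e2 e3)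
  finally have elim: "(\<alpha> - \<omega>) * ((1 + x) * (A1 * A2) * Q x 0 + (1 + x) * (A3 * A4) * Q 0 y)
      + c * N = 0" .
  have \<kappa>: "\<kappa> = 1 + 2 * t - \<alpha>" by (simp add: \<kappa>_def t_def)
  \<comment> \<open>A1 and A2 are \<alpha> - t x minus \<theta> and minus t Y. These two are
    conjugate, with product t^2 x and sum (x - t x^2 - t)/(1 + x), so Y drops out. A3 and A4 have
    the same shape, with \<alpha> - t/x and the two quantities divided by x.\<close>
  have "A1 * A2 = (\<alpha> - t * x) ^ 2 - (\<alpha> - t * x) * (\<theta> + t * Y) + t ^ 2 * x"
    using \<theta>Y unfolding A1_def A2_def by algebra
  hence "(1 + x) * (A1 * A2) = (1 + x) * ((\<alpha> - t * x) ^ 2 + t ^ 2 * x)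
      - (\<alpha> - t * x) * ((1 + x) * (\<theta> + t * Y))" by algebra
  hence coeff1: "(1 + x) * (A1 * A2) = \<alpha> * (\<alpha> + t) - \<alpha> * \<kappa> * x + t * \<kappa> * x ^ 2"
    unfolding \<theta> \<kappa> by algebra
  have "A3 * A4 = (\<alpha> - t * y) ^ 2 - (\<alpha> - t * y) * y * (\<theta> + t * Y) + t ^ 2 * y"
    using \<theta>Y xy unfolding A3_def A4_def by algebra
  hence "(1 + x) * (A3 * A4) = (1 + x) * ((\<alpha> - t * y) ^ 2 + t ^ 2 * y)
      - (\<alpha> - t * y) * y * ((1 + x) * (\<theta> + t * Y))" by algebra
  hence coeff2: "(1 + x) * (A3 * A4) = \<alpha> * (\<alpha> + t) * x - \<alpha> * \<kappa> + t * \<kappa> * y"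
    using xy unfolding \<theta> \<kappa> by algebra
  define v where "v = inverse (\<alpha> - \<omega>)"
  have "(\<alpha> - \<omega>) $ 0 \<noteq> 0"
    using a by (simp add: \<alpha>_def \<omega>_def t_def)
  hence v: "(\<alpha> - \<omega>) * v = 1"
    unfolding v_def by (rule inverse_mult_eq_1')
  have main: "(\<alpha> * (\<alpha> + t) - \<alpha> * \<kappa> * x + t * \<kappa> * x ^ 2) * Q x 0
      + (\<alpha> * (\<alpha> + t) * x - \<alpha> * \<kappa> + t * \<kappa> * y) * Q 0 y = - (c * (N * v))"
    using elim v unfolding coeff1 coeff2 by algebra
  have span: "hyperexp_span x" "hyperexp_span y" "hyperexp_span t" "hyperexp_span \<alpha>"
    unfolding x_def y_def t_def \<alpha>_def by (intro span_intros)+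
  have poly: "is_poly x" "is_poly t" "is_poly \<alpha>"
    unfolding x_def t_def \<alpha>_def by (intro poly_intros)+
  have spanY: "hyperexp_span Y"
  proof (rule hyperexp_span_quadratic)
    show "t * (1 + x) * Y ^ 2 + (t * (x ^ 2 + 1) - x) * Y + t * (x + x ^ 2) = 0"
      using Y xy by algebra
    have "1 + x \<noteq> 0" using w by auto
    thus "t * (1 + x) \<noteq> 0" by (simp add: t_def)
  qed (intro poly_intros poly)+
  have spanw: "hyperexp_span w"
    by (rule hyperexp_span_cancel[of "1 + x"])
       (use w in \<open>auto intro!: poly_intros poly simp: span_intros\<close>)
  have span\<omega>: "hyperexp_span \<omega>"
    unfolding \<omega>_def by (intro span_intros span spanY)
  have spanv: "hyperexp_span v"
  proof (rule hyperexp_span_inverse[OF v])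
    \<comment> \<open>\<omega> and t (1 + 1/x) Y are conjugate: their sum is 1 - t (x + 1/x), their
      product t^2 (1 + x) (1 + 1/x).\<close>
    show P: "(\<alpha> - \<omega>) * (x * (\<alpha> - t * (1 + y) * Y)) =
        x * \<alpha> ^ 2 - x * \<alpha> + \<alpha> * t + t ^ 2 + x * (2 * t ^ 2) + x * (x * (\<alpha> * t + t ^ 2))"
      using \<omega>Y xy unfolding \<omega>_def by algebra
    show "hyperexp_span (x * (\<alpha> - t * (1 + y) * Y))"
      by (intro span_intros span spanY)
    show "is_poly (x * \<alpha> ^ 2 - x * \<alpha> + \<alpha> * t + t ^ 2 + x * (2 * t ^ 2) + x * (x * (\<alpha> * t + t ^ 2)))"
      by (intro poly_intros poly)
    define A where "A = fps_const (1 - 1 / a)"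
    have eq: "\<alpha> = fps_embed A" "t = fps_embed fps_X" "(2 :: 'a fls fps) = fps_embed 2"
      by (simp_all add: \<alpha>_def t_def A_def fps_embed_const fps_numeral_fps_const)
    have "x_coeff 2 (x * \<alpha> ^ 2 - x * \<alpha> + \<alpha> * t + t ^ 2 + x * (2 * t ^ 2) + x * (x * (\<alpha> * t + t ^ 2)))
        = A * fps_X + fps_X ^ 2"
      unfolding eq x_def
      by (simp only: x_coeff_add x_coeff_diff x_coeff_xvar_mult x_coeff_embed
            flip: fps_embed_power fps_embed_mult fps_embed_add) simp
    moreover have "(A * fps_X + fps_X ^ 2) $ 2 = 1"
      by (simp add: A_def numeral_2_eq_2)
    hence "A * fps_X + fps_X ^ 2 \<noteq> 0" by (metis fps_zero_nth zero_neq_one)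
    ultimately show "x * \<alpha> ^ 2 - x * \<alpha> + \<alpha> * t + t ^ 2 + x * (2 * t ^ 2)
        + x * (x * (\<alpha> * t + t ^ 2)) \<noteq> 0"
      by (intro neq_0_if_x_coeff_neq_0[of 2]) simp
  qed
  have "hyperexp_span (N * v)"
    unfolding N_def A1_def A2_def A3_def A4_def \<theta>_def
    by (intro span_intros span spanY spanv spanw span\<omega>)
  with main show ?thesis
    unfolding c_def x_def y_def t_def by blast
qed

lemma model18_ratio_of_D_finite:
  fixes a :: "'a::field_char_0"
  assumes a: "a \<noteq> 0" "a \<noteq> 1"
  shows "ratio_of_D_finite (excursion_gf model18 a a)"
proof -
  define Q where "Q = walk_gf model18 a a"
  define G where "G = endpoint_gf model18 a a (0, 0)"
  define R1 R2 where "R1 = endpoint_gf model18 a a (1, 0)" and "R2 = endpoint_gf model18 a a (0, 1)"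
  define \<alpha> where "\<alpha> = scalar (1 - 1 / a)"
  define \<kappa> where "\<kappa> = 1 + 2 * fps_X - \<alpha>"
  obtain E where E: "hyperexp_span E"
    "(\<alpha> * (\<alpha> + fps_X) - \<alpha> * \<kappa> * xvar + fps_X * \<kappa> * xvar ^ 2) * Q xvar 0
      + (\<alpha> * (\<alpha> + fps_X) * xvar - \<alpha> * \<kappa> + fps_X * \<kappa> * xinv) * Q 0 xinv
    = - ((scalar (1 / (a * a)) - \<alpha> * \<alpha> * Q 0 0) * E)"
    using model18_boundary_equation[OF a(1)] unfolding Q_def \<alpha>_def \<kappa>_def by blast
  define A where "A = fps_const (1 - 1 / a)"
  define k where "k = 1 + 2 * fps_X - A"
  define s where "s = fps_const (a ^ 2)"
  have two: "fps_embed 2 = (2 :: 'a fls fps)"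
    by (simp add: fps_embed_const fps_numeral_fps_const)
  have \<alpha>: "\<alpha> = fps_embed A" by (simp add: \<alpha>_def A_def fps_embed_const)
  have \<kappa>: "\<kappa> = fps_embed k"
    by (simp add: \<kappa>_def k_def \<alpha> two fps_embed_add fps_embed_mult fps_embed_diff)
  define f0 f1 f2 where "f0 = A * (A + fps_X)" and "f1 = A * k" and "f2 = fps_X * k"
  have lhs: "(\<alpha> * (\<alpha> + fps_X) - \<alpha> * \<kappa> * xvar + fps_X * \<kappa> * xvar ^ 2) * Q xvar 0
      + (\<alpha> * (\<alpha> + fps_X) * xvar - \<alpha> * \<kappa> + fps_X * \<kappa> * xinv) * Q 0 xinv =
      fps_embed f0 * Q xvar 0 - fps_embed f1 * (xvar * Q xvar 0) + fps_embed f2 * (xvar * (xvar * Q xvar 0))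
      + fps_embed f0 * (xvar * Q 0 xinv) - fps_embed f1 * Q 0 xinv + fps_embed f2 * (xinv * Q 0 xinv)"
    unfolding f0_def f1_def f2_def fps_embed_mult fps_embed_add fps_embed_X \<alpha> \<kappa>
    by (simp add: algebra_simps power2_eq_square)
  have rhs: "- ((scalar (1 / (a * a)) - \<alpha> * \<alpha> * Q 0 0) * E) =
      - (fps_embed (fps_const (1 / (a * a)) - A * A * G) * E)"
    unfolding Q_def G_def walk_gf_0_0 \<alpha>
    by (simp add: fps_embed_diff fps_embed_mult fps_embed_const)
  note eq = E(2)[unfolded lhs rhs]
  note coeffs = x_coeff_add x_coeff_diff x_coeff_uminus x_coeff_embed_mult x_coeff_xvar_mult
    x_coeff_xinv_mult x_coeff_walk_gf_xvar_0 x_coeff_walk_gf_0_xinv Q_def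
  have eq0: "f0 * G - f1 * G + f0 * R2 = - ((fps_const (1 / (a * a)) - A * A * G) * x_coeff 0 E)"
    using arg_cong[OF eq, of "x_coeff 0"] unfolding coeffs by (simp add: G_def R2_def algebra_simps)
  have eq1: "f0 * R1 - f1 * G + f0 * G = - ((fps_const (1 / (a * a)) - A * A * G) * x_coeff 1 E)"
    using arg_cong[OF eq, of "x_coeff 1"] unfolding coeffs by (simp add: G_def R1_def algebra_simps)
  \<comment> \<open>R1 and R2 enter the two equations with the same coefficient f0. Adding the
    equations leaves only R1 + R2, known from \<open>model18_last_step\<close>, and e collects the
    constant terms.\<close>
  define e where "e = x_coeff 0 (E + xinv * E)"
  have e: "e = x_coeff 0 E + x_coeff 1 E"
    by (simp add: e_def x_coeff_add x_coeff_xinv_mult)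
  have G1: "G = 1 + s * fps_X * (R1 + R2)"
    unfolding G_def R1_def R2_def s_def by (rule model18_last_step)
  have s1: "s * fps_const (1 / (a * a)) = 1" "s * (1 - A) ^ 2 = 1"
  proof -
    show "s * fps_const (1 / (a * a)) = 1" using a by (simp add: s_def power2_eq_square)
    have "1 - A = fps_const (1 / a)"
      by (rule fps_ext) (simp add: A_def)
    thus "s * (1 - A) ^ 2 = 1" using a by (simp add: s_def power2_eq_square)
  qed
  define F where "F = f0 - fps_X * e"
  define H where "H = 2 * (f0 - f1) * fps_X * s + f0 - A ^ 2 * s * fps_X * e"
  have GH: "G * H = F"
  proof -
    have "s * fps_X * (f0 * G - f1 * G + f0 * R2) + s * fps_X * (f0 * R1 - f1 * G + f0 * G) =
        - ((s * fps_const (1 / (a * a)) - s * A * A * G) * fps_X * e)"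
      unfolding eq0 eq1 e by algebra
    hence "2 * (f0 - f1) * fps_X * s * G + f0 * (G - 1) = - ((1 - s * A * A * G) * fps_X * e)"
      unfolding s1(1) using G1 by algebra
    thus ?thesis unfolding F_def H_def by algebra
  qed
  \<comment> \<open>If H = 0 then F = 0, hence t e = f0. Eliminating e leaves a polynomial identity
    in t which, after removal of the nonzero factor s A, has t^2-coefficient -2.\<close>
  have "H \<noteq> 0"
  proof
    assume "H = 0"
    with GH have "F = 0" by simp
    hence "fps_X * e = f0" by (simp add: F_def)
    with \<open>H = 0\<close> have "2 * (f0 - f1) * fps_X * s + f0 * (1 - A ^ 2 * s) = 0"
      unfolding H_def by algebra
    hence "s * A * ((2 * A - 1) * (fps_X - A) - 2 * fps_X ^ 2) = 0"
      using s1(2) unfolding f0_def f1_def k_def by algebra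
    moreover have "s \<noteq> 0" "A \<noteq> 0" using a by (auto simp: s_def A_def)
    ultimately have "((2 * A - 1) * (fps_X - A) - 2 * fps_X ^ 2) $ 2 = 0" by simp
    moreover define p where "p = 2 * (1 - 1 / a) - 1"
    have "2 * A - 1 = fps_const p"
      by (rule fps_ext) (simp add: A_def p_def fps_numeral_fps_const)
    ultimately show False
      by (simp add: A_def right_diff_distrib fps_numeral_fps_const numeral_2_eq_2)
  qed
  moreover have "D_finite F"
  proof -
    have "F = x_coeff 0 (fps_embed f0 - fps_embed fps_X * (E + xinv * E))"
      by (simp only: F_def e_def x_coeff_diff x_coeff_embed_mult x_coeff_embed) simp
    moreover have "hyperexp_span (fps_embed f0 - fps_embed fps_X * (E + xinv * E))"
      unfolding f0_def fps_embed_mult fps_embed_add \<alpha>[symmetric] fps_embed_X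
      unfolding \<alpha>_def by (intro span_intros E(1))
    ultimately show ?thesis by (metis hyperexp_span_constant_term_D_finite)
  qed
  moreover have "D_finite H"
  proof -
    have "H = x_coeff 0 (fps_embed (2 * (f0 - f1) * fps_X * s + f0)
        - fps_embed (A ^ 2 * s * fps_X) * (E + xinv * E))"
      by (simp only: H_def e_def x_coeff_diff x_coeff_embed_mult x_coeff_embed) simp
    moreover have "fps_embed s = scalar (a ^ 2)" by (simp add: s_def fps_embed_const)
    hence "hyperexp_span (fps_embed (2 * (f0 - f1) * fps_X * s + f0)
        - fps_embed (A ^ 2 * s * fps_X) * (E + xinv * E))"
      unfolding f0_def f1_def fps_embed_mult fps_embed_add fps_embed_diff fps_embed_power
        \<alpha>[symmetric] \<kappa>[symmetric] fps_embed_X two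
      unfolding \<alpha>_def \<kappa>_def by (simp only:) (intro span_intros E(1))
    ultimately show ?thesis by (metis hyperexp_span_constant_term_D_finite)
  qed
  ultimately have "ratio_of_D_finite G"
    using GH by (intro ratio_of_D_finiteI)
  thus ?thesis unfolding G_def excursion_gf_eq_endpoint_gf[OF finite_model18] .
qed

theorem theorem3:
  shows "(ratio_of_D_finite (excursion_gf model17 indet_a indet_b) \<and>
          D_finite (excursion_gf model17 indet 1) \<and>
          D_finite (excursion_gf model17 1 indet)) \<and>
         ratio_of_D_finite (excursion_gf model18 indet indet)"
proof -
  have indet: "indet \<noteq> 0" "indet \<noteq> 1"
    by (auto simp: indet_def one_pCons simp flip: to_fract_1)
  have ab: "indet_a \<noteq> 0" "indet_b \<noteq> 0" "indet_a \<noteq> 1"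
    by (auto simp: indet_a_def indet_b_def one_pCons simp flip: to_fract_1)
  \<comment> \<open>This is 1/a + 1/b \<noteq> 1 cleared of denominators, which can be decided in
    the polynomial ring.\<close>
  have "indet_a + indet_b \<noteq> indet_a * indet_b"
    by (simp add: indet_a_def indet_b_def flip: to_fract_add to_fract_mult)
  hence "1 / indet_a + 1 / indet_b \<noteq> 1"
    using ab by (simp add: add_frac_eq)
  with indet ab show ?thesis
    by (simp add: model17_ratio_of_D_finite model17_D_finite_b_eq_1 model17_D_finite_a_eq_1
        model18_ratio_of_D_finite)
qed

end
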